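(* For every integer $n\ge1$, the space $\mathrm{Spec}\,\mathrm{Free}_n(\mathcal V)$ is homeomorphic to $\mathrm{Spec}\,\mathrm{Free}_{n-1}(\mathcal{MV})$.
   Context: $\mathcal V$ is the variety generated by $M=((0,1],\star,\to,1)$ where $\star$ is multiplication of reals and $a\to b=\min\{1,b/a\}$ (falsum-free product logic; equivalently, cancellative Wajsberg hoops). $\mathcal{MV}$ is the variety of MV-algebras, generated by $([0,1],\star,\to,0,1)$ with $a\star b=\max(0,a+b-1)$, $a\to b=\min(1,1-a+b)$. $\mathrm{Free}_k$ denotes the free algebra on $k$ generators. For an algebra $A$ in either variety, a filter is the preimage of $1$ under a homomorphism; a filter $\mathfrak p$ is prime if $\mathfrak p\supseteq\mathfrak f\cap\mathfrak g$ (filters $\mathfrak f,\mathfrak g$) implies $\mathfrak p\supseteq\mathfrak f$ or $\mathfrak p\supseteq\mathfrak g$; $\mathrm{Spec}\,A$ is the set of proper prime filters with the topology whose subbasis consists of the sets $O_a=\{\mathfrak p:a\notin\mathfrak p\}$, $a\in A$. *)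

theory Defs
  imports "HOL-Analysis.Analysis"
begin

text \<open>A signature is an arity function on operation symbols. An algebra has a carrier and interprets
  each symbol as a function on lists, whose values matter only for lists of carrier elements of the
  length given by the arity.\<close>

datatype 'f trm = Var nat | App 'f "'f trm list"

inductive_set terms :: "('f \<Rightarrow> nat) \<Rightarrow> nat set \<Rightarrow> 'f trm set"
  for ar :: "'f \<Rightarrow> nat" and X :: "nat set"
  where
    terms_Var: "i \<in> X \<Longrightarrow> Var i \<in> terms ar X"
  | terms_App: "length ts = ar f \<Longrightarrow> \<forall>t\<in>set ts. t \<in> terms ar X \<Longrightarrow> App f ts \<in> terms ar X"

record ('f, 'a) alg =
  carr :: "'a set"
  oper :: "'f \<Rightarrow> 'a list \<Rightarrow> 'a"

definition is_alg :: "('f \<Rightarrow> nat) \<Rightarrow> ('f, 'a) alg \<Rightarrow> bool" where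
  "is_alg ar A \<longleftrightarrow> carr A \<noteq> {} \<and>
     (\<forall>f xs. length xs = ar f \<longrightarrow> set xs \<subseteq> carr A \<longrightarrow> oper A f xs \<in> carr A)"

definition alg_hom :: "('f \<Rightarrow> nat) \<Rightarrow> ('f, 'a) alg \<Rightarrow> ('f, 'b) alg \<Rightarrow> ('a \<Rightarrow> 'b) \<Rightarrow> bool" where
  "alg_hom ar A B h \<longleftrightarrow> h ` carr A \<subseteq> carr B \<and>
     (\<forall>f xs. length xs = ar f \<longrightarrow> set xs \<subseteq> carr A \<longrightarrow> h (oper A f xs) = oper B f (map h xs))"

fun trm_val :: "('f, 'a) alg \<Rightarrow> (nat \<Rightarrow> 'a) \<Rightarrow> 'f trm \<Rightarrow> 'a" where
  "trm_val A v (Var i) = v i"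
| "trm_val A v (App f ts) = oper A f (map (trm_val A v) ts)"

definition identity_holds :: "('f, 'a) alg \<Rightarrow> 'f trm \<Rightarrow> 'f trm \<Rightarrow> bool" where
  "identity_holds A s t \<longleftrightarrow> (\<forall>v. (\<forall>i. v i \<in> carr A) \<longrightarrow> trm_val A v s = trm_val A v t)"

text \<open>Varieties are equational classes, so the variety generated by \<open>M\<close> consists of the algebras
  (of any carrier type) satisfying all identities of \<open>M\<close>.\<close>

definition in_variety :: "('f \<Rightarrow> nat) \<Rightarrow> ('f, 'm) alg \<Rightarrow> ('f, 'a) alg \<Rightarrow> bool" where
  "in_variety ar M A \<longleftrightarrow> is_alg ar A \<and>
     (\<forall>s\<in>terms ar UNIV. \<forall>t\<in>terms ar UNIV. identity_holds M s t \<longrightarrow> identity_holds A s t)"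

text \<open>The free algebra on \<open>k\<close> generators of the variety generated by \<open>M\<close>: terms in \<open>k\<close> variables
  modulo the identities of the variety. Its universal property is \<open>free_alg_universal\<close> below.\<close>

definition ident_rel :: "('f \<Rightarrow> nat) \<Rightarrow> ('f, 'm) alg \<Rightarrow> nat \<Rightarrow> 'f trm rel" where
  "ident_rel ar M k =
     {(s, t). s \<in> terms ar {..<k} \<and> t \<in> terms ar {..<k} \<and> identity_holds M s t}"

definition free_alg :: "('f \<Rightarrow> nat) \<Rightarrow> ('f, 'm) alg \<Rightarrow> nat \<Rightarrow> ('f, 'f trm set) alg" where
  "free_alg ar M k =
     \<lparr>carr = terms ar {..<k} // ident_rel ar M k,
      oper = (\<lambda>f Cs. ident_rel ar M k `` {App f ts |ts. list_all2 (\<in>) ts Cs})\<rparr>"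

text \<open>Here \<open>e\<close> is the constant symbol denoting \<open>1\<close>, and the filters of \<open>A\<close> are the preimages of \<open>1\<close>
  under homomorphisms into algebras of the variety. The codomains are taken with carrier type
  \<open>'a set\<close>, which is no restriction: see \<open>alg_filter_preimage\<close> below.\<close>

definition alg_filter ::
  "('f \<Rightarrow> nat) \<Rightarrow> 'f \<Rightarrow> ('f, 'm) alg \<Rightarrow> ('f, 'a) alg \<Rightarrow> 'a set \<Rightarrow> bool" where
  "alg_filter ar e M A F \<longleftrightarrow>
     (\<exists>(B :: ('f, 'a set) alg) h. in_variety ar M B \<and> alg_hom ar A B h \<and>
        F = {a \<in> carr A. h a = oper B e []})"

definition prime_filter ::
  "('f \<Rightarrow> nat) \<Rightarrow> 'f \<Rightarrow> ('f, 'm) alg \<Rightarrow> ('f, 'a) alg \<Rightarrow> 'a set \<Rightarrow> bool" where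
  "prime_filter ar e M A P \<longleftrightarrow> alg_filter ar e M A P \<and>
     (\<forall>F G. alg_filter ar e M A F \<longrightarrow> alg_filter ar e M A G \<longrightarrow> F \<inter> G \<subseteq> P \<longrightarrow> F \<subseteq> P \<or> G \<subseteq> P)"

definition spec_points ::
  "('f \<Rightarrow> nat) \<Rightarrow> 'f \<Rightarrow> ('f, 'm) alg \<Rightarrow> ('f, 'a) alg \<Rightarrow> 'a set set" where
  "spec_points ar e M A = {P. prime_filter ar e M A P \<and> P \<noteq> carr A}"

text \<open>The sets \<open>O\<^sub>a\<close> cover the set of proper prime filters, so the topology they generate has all
  of it as underlying space (\<open>topspace_Spec\<close> below).\<close>

definition Spec ::
  "('f \<Rightarrow> nat) \<Rightarrow> 'f \<Rightarrow> ('f, 'm) alg \<Rightarrow> ('f, 'a) alg \<Rightarrow> 'a set topology" where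
  "Spec ar e M A =
     topology_generated_by ((\<lambda>a. {P \<in> spec_points ar e M A. a \<notin> P}) ` carr A)"


datatype hoop_op = HMul | HImp | HOne

fun hoop_ar :: "hoop_op \<Rightarrow> nat" where
  "hoop_ar HMul = 2"
| "hoop_ar HImp = 2"
| "hoop_ar HOne = 0"

fun product_oper :: "hoop_op \<Rightarrow> real list \<Rightarrow> real" where
  "product_oper HMul [a, b] = a * b"
| "product_oper HImp [a, b] = min 1 (b / a)"
| "product_oper HOne [] = 1"

definition product_alg :: "(hoop_op, real) alg" where
  "product_alg = \<lparr>carr = {0<..1}, oper = product_oper\<rparr>"

datatype mv_op = MVMul | MVImp | MVZero | MVOne

fun mv_ar :: "mv_op \<Rightarrow> nat" where
  "mv_ar MVMul = 2"
| "mv_ar MVImp = 2"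
| "mv_ar MVZero = 0"
| "mv_ar MVOne = 0"

fun lukasiewicz_oper :: "mv_op \<Rightarrow> real list \<Rightarrow> real" where
  "lukasiewicz_oper MVMul [a, b] = max 0 (a + b - 1)"
| "lukasiewicz_oper MVImp [a, b] = min 1 (1 - a + b)"
| "lukasiewicz_oper MVZero [] = 0"
| "lukasiewicz_oper MVOne [] = 1"

definition lukasiewicz_alg :: "(mv_op, real) alg" where
  "lukasiewicz_alg = \<lparr>carr = {0..1}, oper = lukasiewicz_oper\<rparr>"

definition Free_V :: "nat \<Rightarrow> (hoop_op, hoop_op trm set) alg" where
  "Free_V n = free_alg hoop_ar product_alg n"

definition Free_MV :: "nat \<Rightarrow> (mv_op, mv_op trm set) alg" where
  "Free_MV n = free_alg mv_ar lukasiewicz_alg n"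

definition Spec_V :: "(hoop_op, 'a) alg \<Rightarrow> 'a set topology" where
  "Spec_V A = Spec hoop_ar HOne product_alg A"

definition Spec_MV :: "(mv_op, 'a) alg \<Rightarrow> 'a set topology" where
  "Spec_MV A = Spec mv_ar MVOne lukasiewicz_alg A"


lemma is_alg_product_alg: "is_alg hoop_ar product_alg"
proof -
  have "oper product_alg f xs \<in> carr product_alg"
    if "length xs = hoop_ar f" "set xs \<subseteq> carr product_alg" for f xs
    using that by (cases f) (auto simp: product_alg_def length_Suc_conv numeral_2_eq_2 mult_le_one)
  moreover have "carr product_alg \<noteq> {}" by (simp add: product_alg_def)
  ultimately show ?thesis by (auto simp: is_alg_def)
qed

lemma is_alg_lukasiewicz_alg: "is_alg mv_ar lukasiewicz_alg"
proof -
  have "oper lukasiewicz_alg f xs \<in> carr lukasiewicz_alg"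
    if "length xs = mv_ar f" "set xs \<subseteq> carr lukasiewicz_alg" for f xs
    using that by (cases f) (auto simp: lukasiewicz_alg_def length_Suc_conv numeral_2_eq_2)
  moreover have "carr lukasiewicz_alg \<noteq> {}" by (simp add: lukasiewicz_alg_def)
  ultimately show ?thesis by (auto simp: is_alg_def)
qed

lemma trm_val_closed:
  assumes A: "is_alg ar A" and t: "t \<in> terms ar X" and v: "\<And>i. i \<in> X \<Longrightarrow> v i \<in> carr A"
  shows "trm_val A v t \<in> carr A"
  using t
proof (induction rule: terms.induct)
  case (terms_Var i)
  then show ?case by (simp add: v)
next
  case (terms_App ts f)
  have "set (map (trm_val A v) ts) \<subseteq> carr A" using terms_App by auto
  then show ?case using A terms_App(1) by (simp add: is_alg_def)
qed

lemma trm_val_cong: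
  assumes "t \<in> terms ar X" "\<And>i. i \<in> X \<Longrightarrow> v i = w i"
  shows "trm_val A v t = trm_val A w t"
  using assms(1)
proof (induction rule: terms.induct)
  case (terms_App ts f)
  then have "map (trm_val A v) ts = map (trm_val A w) ts" by auto
  then show ?case by (simp only: trm_val.simps)
qed (simp add: assms(2))

lemma trm_val_hom:
  assumes A: "is_alg ar A" and h: "alg_hom ar A B h" and t: "t \<in> terms ar X"
    and v: "\<And>i. i \<in> X \<Longrightarrow> v i \<in> carr A"
  shows "h (trm_val A v t) = trm_val B (\<lambda>i. h (v i)) t"
  using t
proof (induction rule: terms.induct)
  case (terms_App ts f)
  have "set (map (trm_val A v) ts) \<subseteq> carr A"
    using terms_App trm_val_closed[OF A _ v] by auto
  moreover have "map h (map (trm_val A v) ts) = map (trm_val B (\<lambda>i. h (v i))) ts"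
    using terms_App by auto
  ultimately show ?case using h terms_App(1) by (simp add: alg_hom_def del: map_map)
qed simp

lemma terms_mono: "t \<in> terms ar X \<Longrightarrow> X \<subseteq> Y \<Longrightarrow> t \<in> terms ar Y"
  by (induction rule: terms.induct) (auto intro: terms.intros)

lemma equiv_ident_rel: "equiv (terms ar {..<k}) (ident_rel ar M k)"
  by (rule equivI) (auto simp: ident_rel_def identity_holds_def refl_on_def sym_def trans_def)

lemma ident_rel_App:
  assumes "length ts = ar f" "list_all2 (\<lambda>s t. (s, t) \<in> ident_rel ar M k) ts us"
  shows "(App f ts, App f us) \<in> ident_rel ar M k"
proof -
  have *: "length us = length ts"
    "\<And>i. i < length ts \<Longrightarrow> (ts ! i, us ! i) \<in> ident_rel ar M k"
    using assms(2) by (auto simp: list_all2_conv_all_nth)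
  have "App f ts \<in> terms ar {..<k}" "App f us \<in> terms ar {..<k}"
    using * assms(1) by (auto intro!: terms.intros simp: in_set_conv_nth ident_rel_def)
  moreover have "map (trm_val M v) ts = map (trm_val M v) us" if "\<forall>i. v i \<in> carr M" for v
    using * that by (intro nth_equalityI) (auto simp: ident_rel_def identity_holds_def)
  ultimately show ?thesis by (auto simp: ident_rel_def identity_holds_def)
qed

lemma oper_free_alg:
  assumes len: "length ts = ar f" and ts: "set ts \<subseteq> terms ar {..<k}"
  shows "oper (free_alg ar M k) f (map (\<lambda>t. ident_rel ar M k `` {t}) ts) =
           ident_rel ar M k `` {App f ts}"
proof -
  let ?r = "ident_rel ar M k"
  have refl: "list_all2 (\<in>) ts (map (\<lambda>t. ?r `` {t}) ts)"
    using ts by (auto simp: list_all2_conv_all_nth ident_rel_def identity_holds_def)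
  have "?r `` {App f us} = ?r `` {App f ts}" if "list_all2 (\<in>) us (map (\<lambda>t. ?r `` {t}) ts)" for us
  proof -
    have "list_all2 (\<lambda>s t. (s, t) \<in> ?r) ts us"
      using that by (auto simp: list_all2_conv_all_nth)
    from ident_rel_App[of ts ar f M k us, OF len this] show ?thesis
      using equiv_class_eq[OF equiv_ident_rel] by blast
  qed
  then have "?r `` {App f us |us. list_all2 (\<in>) us (map (\<lambda>t. ?r `` {t}) ts)} = ?r `` {App f ts}"
    using refl by blast
  then show ?thesis by (simp add: free_alg_def)
qed

lemma free_alg_representatives:
  assumes "set Cs \<subseteq> carr (free_alg ar M k)"
  obtains ts where "set ts \<subseteq> terms ar {..<k}" "Cs = map (\<lambda>t. ident_rel ar M k `` {t}) ts"
proof -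
  have "\<forall>C\<in>set Cs. \<exists>t\<in>terms ar {..<k}. C = ident_rel ar M k `` {t}"
    using assms by (auto simp: free_alg_def quotient_def)
  then obtain g where "\<forall>C\<in>set Cs. g C \<in> terms ar {..<k} \<and> C = ident_rel ar M k `` {g C}"
    by metis
  then show ?thesis by (intro that[of "map g Cs"]) (auto intro!: nth_equalityI)
qed

lemma is_alg_free_alg:
  assumes "terms ar {..<k} \<noteq> {}"
  shows "is_alg ar (free_alg ar M k)"
proof -
  have "oper (free_alg ar M k) f Cs \<in> carr (free_alg ar M k)"
    if len: "length Cs = ar f" and Cs: "set Cs \<subseteq> carr (free_alg ar M k)" for f Cs
  proof -
    obtain ts where ts: "set ts \<subseteq> terms ar {..<k}" "Cs = map (\<lambda>t. ident_rel ar M k `` {t}) ts"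
      using free_alg_representatives[OF Cs] .
    have "App f ts \<in> terms ar {..<k}" using ts len by (auto intro: terms.intros)
    then show ?thesis
      using oper_free_alg[of ts ar f k M] ts len by (auto simp: free_alg_def quotient_def)
  qed
  then show ?thesis using assms by (auto simp: is_alg_def free_alg_def)
qed

primrec trm_subst :: "(nat \<Rightarrow> 'f trm) \<Rightarrow> 'f trm \<Rightarrow> 'f trm" where
  "trm_subst \<sigma> (Var i) = \<sigma> i"
| "trm_subst \<sigma> (App f ts) = App f (map (trm_subst \<sigma>) ts)"

lemma trm_subst_terms:
  "t \<in> terms ar UNIV \<Longrightarrow> (\<And>i. \<sigma> i \<in> terms ar X) \<Longrightarrow> trm_subst \<sigma> t \<in> terms ar X"
  by (induction rule: terms.induct) (auto intro!: terms.intros)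

lemma trm_val_subst: "trm_val M v (trm_subst \<sigma> t) = trm_val M (\<lambda>i. trm_val M v (\<sigma> i)) t"
  by (induction t) (auto intro!: arg_cong[where f = "oper M _"])

lemma trm_val_free_alg:
  assumes "t \<in> terms ar X" "\<And>i. i \<in> X \<Longrightarrow> \<sigma> i \<in> terms ar {..<k}"
  shows "trm_val (free_alg ar M k) (\<lambda>i. ident_rel ar M k `` {\<sigma> i}) t =
           ident_rel ar M k `` {trm_subst \<sigma> t} \<and> trm_subst \<sigma> t \<in> terms ar {..<k}"
  using assms(1)
proof (induction rule: terms.induct)
  case (terms_App ts f)
  have "map (trm_val (free_alg ar M k) (\<lambda>i. ident_rel ar M k `` {\<sigma> i})) ts =
          map (\<lambda>t. ident_rel ar M k `` {t}) (map (trm_subst \<sigma>) ts)"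
    using terms_App by auto
  moreover have "set (map (trm_subst \<sigma>) ts) \<subseteq> terms ar {..<k}"
    using terms_App by auto
  moreover have "trm_subst \<sigma> (App f ts) \<in> terms ar {..<k}"
    using terms_App by (auto intro!: terms.terms_App)
  ultimately show ?case
    using oper_free_alg[of "map (trm_subst \<sigma>) ts" ar f k M] terms_App(1)
    by (simp del: map_map)
qed (simp add: assms(2))

lemma free_alg_in_variety:
  assumes M: "is_alg ar M" and ne: "terms ar {..<k} \<noteq> {}"
  shows "in_variety ar M (free_alg ar M k)"
proof -
  let ?F = "free_alg ar M k" and ?r = "ident_rel ar M k"
  have "trm_val ?F v s = trm_val ?F v t"
    if s: "s \<in> terms ar UNIV" and t: "t \<in> terms ar UNIV" and st: "identity_holds M s t"
      and v: "\<forall>i. v i \<in> carr ?F" for s t v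
  proof -
    have "\<forall>i. \<exists>u. u \<in> terms ar {..<k} \<and> v i = ?r `` {u}"
      using v by (auto simp: free_alg_def quotient_def)
    then obtain \<sigma> where \<sigma>: "\<And>i. \<sigma> i \<in> terms ar {..<k}" "v = (\<lambda>i. ?r `` {\<sigma> i})"
      by (metis ext)
    have "identity_holds M (trm_subst \<sigma> s) (trm_subst \<sigma> t)"
      unfolding identity_holds_def trm_val_subst
    proof (intro allI impI)
      fix w :: "nat \<Rightarrow> _" assume w: "\<forall>i. w i \<in> carr M"
      have "\<forall>i. trm_val M w (\<sigma> i) \<in> carr M" using trm_val_closed[OF M \<sigma>(1)] w by blast
      then show "trm_val M (\<lambda>i. trm_val M w (\<sigma> i)) s = trm_val M (\<lambda>i. trm_val M w (\<sigma> i)) t"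
        using st by (simp add: identity_holds_def)
    qed
    then have "(trm_subst \<sigma> s, trm_subst \<sigma> t) \<in> ?r"
      using trm_subst_terms[of _ ar \<sigma> "{..<k}"] s t \<sigma>(1) by (simp add: ident_rel_def)
    then have "?r `` {trm_subst \<sigma> s} = ?r `` {trm_subst \<sigma> t}"
      by (rule equiv_class_eq[OF equiv_ident_rel])
    then show ?thesis
      using trm_val_free_alg[of s ar UNIV \<sigma> k M] trm_val_free_alg[of t ar UNIV \<sigma> k M] s t \<sigma> by simp
  qed
  then show ?thesis
    using is_alg_free_alg[OF ne] unfolding in_variety_def identity_holds_def by blast
qed

theorem free_alg_universal:
  fixes B :: "('f, 'b) alg"
  assumes B: "in_variety ar M B" and v: "\<And>i. i < k \<Longrightarrow> v i \<in> carr B"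
  shows "\<exists>h. alg_hom ar (free_alg ar M k) B h \<and> (\<forall>i<k. h (ident_rel ar M k `` {Var i}) = v i) \<and>
           (\<forall>g. alg_hom ar (free_alg ar M k) B g \<and>
                (\<forall>i<k. g (ident_rel ar M k `` {Var i}) = v i) \<longrightarrow>
              (\<forall>x\<in>carr (free_alg ar M k). g x = h x))"
proof -
  let ?F = "free_alg ar M k" and ?r = "ident_rel ar M k"
  have algB: "is_alg ar B" using B by (simp add: in_variety_def)
  then obtain b where b: "b \<in> carr B" by (auto simp: is_alg_def)
  define w where "w i = (if i < k then v i else b)" for i
  have w: "w i \<in> carr B" for i using b v by (simp add: w_def)
  define h where "h C = trm_val B w (SOME t. t \<in> C)" for C
  have h: "h (?r `` {t}) = trm_val B w t" if t: "t \<in> terms ar {..<k}" for t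
  proof -
    have "t \<in> ?r `` {t}" using equiv_class_self[OF equiv_ident_rel t] .
    then have "(SOME u. u \<in> ?r `` {t}) \<in> ?r `` {t}" by (rule someI)
    then have "(t, SOME u. u \<in> ?r `` {t}) \<in> ?r" by blast
    then have "identity_holds B t (SOME u. u \<in> ?r `` {t})"
      using B terms_mono[of _ ar "{..<k}" UNIV] by (auto simp: ident_rel_def in_variety_def)
    then show ?thesis using w by (auto simp: identity_holds_def h_def)
  qed
  have "h ` carr ?F \<subseteq> carr B"
    using h trm_val_closed[OF algB _ w] by (auto simp: free_alg_def quotient_def)
  moreover have "h (oper ?F f Cs) = oper B f (map h Cs)"
    if len: "length Cs = ar f" and Cs: "set Cs \<subseteq> carr ?F" for f Cs
  proof -
    obtain ts where ts: "set ts \<subseteq> terms ar {..<k}" "Cs = map (\<lambda>t. ?r `` {t}) ts"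
      using free_alg_representatives[OF Cs] .
    have "App f ts \<in> terms ar {..<k}" using ts len by (auto intro: terms.intros)
    then have "h (oper ?F f Cs) = oper B f (map (trm_val B w) ts)"
      using oper_free_alg[of ts ar f k M] ts len h by simp
    also have "map (trm_val B w) ts = map h Cs" using ts h by auto
    finally show ?thesis .
  qed
  ultimately have hom: "alg_hom ar ?F B h" by (auto simp: alg_hom_def)
  have gen: "\<forall>i<k. h (?r `` {Var i}) = v i" using h by (simp add: w_def terms.intros)
  have "g x = h x"
    if g: "alg_hom ar ?F B g" "\<forall>i<k. g (?r `` {Var i}) = v i" and x: "x \<in> carr ?F" for g x
  proof -
    have "g (?r `` {t}) = trm_val B w t" if "t \<in> terms ar {..<k}" for t
      using that
    proof (induction rule: terms.induct)
      case (terms_Var i)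
      then show ?case using g(2) by (simp add: w_def)
    next
      case (terms_App ts f)
      let ?Cs = "map (\<lambda>t. ?r `` {t}) ts"
      have ts: "set ts \<subseteq> terms ar {..<k}" using terms_App by auto
      then have "set ?Cs \<subseteq> carr ?F" by (auto simp: free_alg_def quotient_def)
      then have "g (oper ?F f ?Cs) = oper B f (map g ?Cs)"
        using g(1) terms_App(1) by (simp add: alg_hom_def del: map_map)
      moreover have "map g ?Cs = map (trm_val B w) ts" using terms_App by auto
      ultimately show ?case
        by (simp only: trm_val.simps oper_free_alg[OF terms_App(1) ts])
    qed
    then show ?thesis using h x by (auto simp: free_alg_def quotient_def)
  qed
  then show ?thesis using hom gen by blast
qed

theorem alg_filter_preimage:
  fixes A :: "('f, 'a) alg" and B :: "('f, 'b) alg"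
  assumes A: "is_alg ar A" and e: "ar e = 0"
    and B: "in_variety ar M B" and h: "alg_hom ar A B h"
  shows "alg_filter ar e M A {a \<in> carr A. h a = oper B e []}"
proof -
  define \<kappa> where "\<kappa> b = {a \<in> carr A. h a = b}" for b
  define \<rho> where "\<rho> C = h (SOME a. a \<in> C)" for C :: "'a set"
  have \<rho>\<kappa>: "\<rho> (\<kappa> (h a)) = h a" if "a \<in> carr A" for a
    using someI[of "\<lambda>x. x \<in> \<kappa> (h a)" a] that by (auto simp: \<rho>_def \<kappa>_def)
  define C :: "('f, 'a set) alg"
    where "C = \<lparr>carr = \<kappa> ` h ` carr A, oper = (\<lambda>f Cs. \<kappa> (oper B f (map \<rho> Cs)))\<rparr>"
  have algB: "is_alg ar B" using B by (simp add: in_variety_def)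
  have img: "oper B f bs \<in> h ` carr A" if "length bs = ar f" "set bs \<subseteq> h ` carr A" for f bs
  proof -
    have "\<forall>b\<in>set bs. \<exists>a\<in>carr A. b = h a" using that by auto
    then obtain g where "\<forall>b\<in>set bs. g b \<in> carr A \<and> b = h (g b)" by metis
    then have "set (map g bs) \<subseteq> carr A" "map h (map g bs) = bs" by (auto intro: map_idI)
    then have "oper B f bs = h (oper A f (map g bs))" "oper A f (map g bs) \<in> carr A"
      using h A that(1) by (auto simp: alg_hom_def is_alg_def simp del: map_map)
    then show ?thesis by blast
  qed
  have \<rho>_img: "\<rho> D \<in> h ` carr A" if "D \<in> carr C" for D
    using that \<rho>\<kappa> by (auto simp: C_def)
  have algC: "is_alg ar C"
  proof -
    have "oper C f Cs \<in> carr C" if "length Cs = ar f" "set Cs \<subseteq> carr C" for f Cs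
    proof -
      have "oper B f (map \<rho> Cs) \<in> h ` carr A" using that img[of "map \<rho> Cs" f] \<rho>_img by auto
      then show ?thesis by (simp add: C_def)
    qed
    moreover have "carr C \<noteq> {}" using A by (auto simp: C_def is_alg_def)
    ultimately show ?thesis by (auto simp: is_alg_def)
  qed
  have \<kappa>\<rho>: "\<kappa> (\<rho> D) = D" if "D \<in> carr C" for D
    using that \<rho>\<kappa> by (auto simp: C_def)
  have \<rho>_hom: "alg_hom ar C B \<rho>"
  proof -
    have "\<rho> (oper C f Cs) = oper B f (map \<rho> Cs)" if "length Cs = ar f" "set Cs \<subseteq> carr C" for f Cs
    proof -
      have "oper B f (map \<rho> Cs) \<in> h ` carr A" using that img[of "map \<rho> Cs" f] \<rho>_img by auto
      then show ?thesis using \<rho>\<kappa> by (auto simp: C_def)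
    qed
    moreover have "\<rho> ` carr C \<subseteq> carr B" using \<rho>_img h by (auto simp: alg_hom_def)
    ultimately show ?thesis by (auto simp: alg_hom_def)
  qed
  have "in_variety ar M C"
  proof -
    have "trm_val C v s = trm_val C v t"
      if s: "s \<in> terms ar UNIV" and t: "t \<in> terms ar UNIV" and st: "identity_holds M s t"
        and v: "\<forall>i. v i \<in> carr C" for s t v
    proof -
      have "\<forall>i. \<rho> (v i) \<in> carr B" using v \<rho>_hom by (auto simp: alg_hom_def)
      moreover have "identity_holds B s t" using B s t st by (simp add: in_variety_def)
      ultimately have "trm_val B (\<lambda>i. \<rho> (v i)) s = trm_val B (\<lambda>i. \<rho> (v i)) t"
        by (simp add: identity_holds_def)
      then have "\<rho> (trm_val C v s) = \<rho> (trm_val C v t)"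
        using trm_val_hom[OF algC \<rho>_hom s, of v] trm_val_hom[OF algC \<rho>_hom t, of v] v by simp
      then show ?thesis
        using \<kappa>\<rho> trm_val_closed[OF algC s, of v] trm_val_closed[OF algC t, of v] v by metis
    qed
    then show ?thesis using algC unfolding in_variety_def identity_holds_def by blast
  qed
  moreover have "alg_hom ar A C (\<kappa> \<circ> h)"
  proof -
    have "(\<kappa> \<circ> h) (oper A f xs) = oper C f (map (\<kappa> \<circ> h) xs)"
      if "length xs = ar f" "set xs \<subseteq> carr A" for f xs
    proof -
      have "map \<rho> (map (\<kappa> \<circ> h) xs) = map h xs" using that \<rho>\<kappa> by auto
      moreover have "h (oper A f xs) = oper B f (map h xs)" using that h by (simp add: alg_hom_def)
      ultimately show ?thesis by (simp only: C_def comp_apply alg.simps)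
    qed
    moreover have "(\<kappa> \<circ> h) ` carr A \<subseteq> carr C" by (auto simp: C_def)
    ultimately show ?thesis by (simp add: alg_hom_def del: comp_apply)
  qed
  moreover have "{a \<in> carr A. h a = oper B e []} = {a \<in> carr A. (\<kappa> \<circ> h) a = oper C e []}"
  proof -
    have "oper B e [] \<in> h ` carr A" using img[of "[]" e] e by simp
    then have "h a = oper B e [] \<longleftrightarrow> \<kappa> (h a) = \<kappa> (oper B e [])" if "a \<in> carr A" for a
      using \<rho>\<kappa> that by (metis imageE)
    then show ?thesis by (auto simp: C_def)
  qed
  ultimately show ?thesis unfolding alg_filter_def by blast
qed

lemma topspace_Spec: "topspace (Spec ar e M A) = spec_points ar e M A"
proof -
  have "\<exists>a\<in>carr A. a \<notin> P" if "P \<in> spec_points ar e M A" for P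
    using that by (auto simp: spec_points_def prime_filter_def alg_filter_def)
  then show ?thesis by (auto simp: Spec_def)
qed

lemma Free_in_variety:
  "in_variety hoop_ar product_alg (Free_V n)"
  "in_variety mv_ar lukasiewicz_alg (Free_MV n)"
proof -
  have "App HOne [] \<in> terms hoop_ar {..<n}" "App MVOne [] \<in> terms mv_ar {..<n}"
    by (auto intro!: terms.intros)
  then show "in_variety hoop_ar product_alg (Free_V n)"
    "in_variety mv_ar lukasiewicz_alg (Free_MV n)"
    unfolding Free_V_def Free_MV_def
    using free_alg_in_variety is_alg_product_alg is_alg_lukasiewicz_alg by blast+
qed

end

theory Submission
  imports Defs
begin

text \<open>Taking \<open>-ln\<close> turns the hoop side into the positive cone \<open>A\<close> of the lattice-ordered group of
  homogeneous integer piecewise linear functions on the orthant with coordinates \<open>x\<^sub>0, \<dots>, x\<^sub>d\<close>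
  (\<open>d = n - 1\<close>), in which \<open>u = x\<^sub>d + max {x\<^sub>0, \<dots>, x\<^bsub>d-1\<^esub>}\<close> (\<open>u = x\<^sub>0\<close> if \<open>d = 0\<close>) is a strong unit.
  The section \<open>u = 1\<close> of the orthant is the cube, via \<open>y \<mapsto> (y, 1 - max y)\<close>, so Mundici's functor
  identifies the free MV-algebra (in the reversed order \<open>a \<mapsto> 1 - a\<close>) with the segment \<open>[0, u]\<close> of
  \<open>A\<close>. Filters become ideals; an ideal of \<open>A\<close> is determined by its trace on \<open>[0, u]\<close>, since
  \<open>a \<le> m u\<close> implies \<open>a \<le> max m 1 \<cdot> min a u\<close>.\<close>

section \<open>Generators with the same identities\<close>

lemma identity_holds_bij_hom:
  fixes A :: "('f, 'a) alg" and B :: "('f, 'b) alg"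
  assumes A: "is_alg ar A" and h: "alg_hom ar A B h" and bij: "bij_betw h (carr A) (carr B)"
    and s: "s \<in> terms ar UNIV" and t: "t \<in> terms ar UNIV"
  shows "identity_holds A s t \<longleftrightarrow> identity_holds B s t"
proof
  assume A_st: "identity_holds A s t"
  show "identity_holds B s t" unfolding identity_holds_def
  proof (intro allI impI)
    fix v :: "nat \<Rightarrow> 'b" assume v: "\<forall>i. v i \<in> carr B"
    define w where "w i = the_inv_into (carr A) h (v i)" for i :: nat
    have w: "w i \<in> carr A" "h (w i) = v i" for i
      using bij v f_the_inv_into_f_bij_betw[OF bij] bij_betw_the_inv_into[OF bij]
      by (auto simp: w_def bij_betw_def)
    have "trm_val A w s = trm_val A w t" using A_st w by (simp add: identity_holds_def)
    then show "trm_val B v s = trm_val B v t"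
      using trm_val_hom[OF A h s, of w] trm_val_hom[OF A h t, of w] w by simp
  qed
next
  assume B_st: "identity_holds B s t"
  show "identity_holds A s t" unfolding identity_holds_def
  proof (intro allI impI)
    fix v :: "nat \<Rightarrow> 'a" assume v: "\<forall>i. v i \<in> carr A"
    then have "\<forall>i. h (v i) \<in> carr B" using h by (auto simp: alg_hom_def)
    then have "h (trm_val A v s) = h (trm_val A v t)"
      using B_st trm_val_hom[OF A h s, of v] trm_val_hom[OF A h t, of v] v
      by (simp add: identity_holds_def)
    then show "trm_val A v s = trm_val A v t"
      using bij trm_val_closed[OF A s, of v] trm_val_closed[OF A t, of v] v
      by (auto simp: bij_betw_def dest: inj_onD)
  qed
qed

lemma in_variety_generator_cong:
  assumes "\<And>s t. s \<in> terms ar UNIV \<Longrightarrow> t \<in> terms ar UNIV \<Longrightarrow>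
             identity_holds M s t \<longleftrightarrow> identity_holds N s t"
  shows "in_variety ar M B = in_variety ar N B"
  using assms unfolding in_variety_def by blast

lemma alg_filter_generator_cong:
  fixes M :: "('f, 'm) alg" and N :: "('f, 'n) alg" and A :: "('f, 'a) alg"
  assumes "\<And>s t. s \<in> terms ar UNIV \<Longrightarrow> t \<in> terms ar UNIV \<Longrightarrow>
             identity_holds M s t \<longleftrightarrow> identity_holds N s t"
  shows "alg_filter ar e M A F = alg_filter ar e N A F"
proof -
  have "in_variety ar M B = in_variety ar N B" for B :: "('f, 'a set) alg"
    using assms by (rule in_variety_generator_cong)
  then show ?thesis by (simp add: alg_filter_def)
qed

lemma Spec_free_alg_generator_cong:
  assumes "\<And>s t. s \<in> terms ar UNIV \<Longrightarrow> t \<in> terms ar UNIV \<Longrightarrow>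
             identity_holds M s t \<longleftrightarrow> identity_holds N s t"
  shows "Spec ar e M (free_alg ar M k) = Spec ar e N (free_alg ar N k)"
proof -
  have "ident_rel ar M k = ident_rel ar N k"
    using assms terms_mono[of _ ar "{..<k}" UNIV] unfolding ident_rel_def by blast
  then have "free_alg ar M k = free_alg ar N k" by (simp add: free_alg_def)
  then show ?thesis
    by (simp add: Spec_def spec_points_def prime_filter_def
        alg_filter_generator_cong[of ar M N, OF assms])
qed

section \<open>Filters as implicative filters\<close>

locale implicative_generator =
  fixes ar :: "'f \<Rightarrow> nat" and e i :: 'f and M :: "('f, 'm) alg"
  assumes ar_e: "ar e = 0" and ar_i: "ar i = 2" and ar_cases: "\<And>f. ar f = 0 \<or> ar f = 2"
    and imp_refl_M: "\<And>x. x \<in> carr M \<Longrightarrow> oper M i [x, x] = oper M e []"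
    and one_imp_M: "\<And>x. x \<in> carr M \<Longrightarrow> oper M i [oper M e [], x] = x"
    and imp_one_M: "\<And>x. x \<in> carr M \<Longrightarrow> oper M i [x, oper M e []] = oper M e []"
    and imp_trans_M: "\<And>x y z. \<lbrakk>x \<in> carr M; y \<in> carr M; z \<in> carr M\<rbrakk> \<Longrightarrow>
      oper M i [oper M i [x, y], oper M i [oper M i [y, z], oper M i [x, z]]] = oper M e []"
    and cong1_M: "\<And>f x y z. \<lbrakk>ar f = 2; x \<in> carr M; y \<in> carr M; z \<in> carr M\<rbrakk> \<Longrightarrow>
      oper M i [oper M i [x, y], oper M i [oper M i [y, x],
        oper M i [oper M f [x, z], oper M f [y, z]]]] = oper M e []"
    and cong2_M: "\<And>f x y z. \<lbrakk>ar f = 2; x \<in> carr M; y \<in> carr M; z \<in> carr M\<rbrakk> \<Longrightarrow>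
      oper M i [oper M i [x, y], oper M i [oper M i [y, x],
        oper M i [oper M f [z, x], oper M f [z, y]]]] = oper M e []"
begin

lemma transfer_identity:
  assumes A: "in_variety ar M A" and s: "s \<in> terms ar UNIV" and t: "t \<in> terms ar UNIV"
    and st: "\<And>v. (\<And>k. v k \<in> carr M) \<Longrightarrow> trm_val M v s = trm_val M v t"
    and w: "\<And>k. w k \<in> carr A"
  shows "trm_val A w s = trm_val A w t"
  using assms unfolding in_variety_def identity_holds_def by blast

lemma binary_term:
  "ar f = 2 \<Longrightarrow> s \<in> terms ar X \<Longrightarrow> t \<in> terms ar X \<Longrightarrow> App f [s, t] \<in> terms ar X"
  by (auto intro!: terms.intros)

lemma one_term: "App e [] \<in> terms ar X"
  using ar_e by (auto intro!: terms.intros)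

context
  fixes A :: "('f, 'a) alg"
  assumes A: "in_variety ar M A"
begin

lemma one_closed: "oper A e [] \<in> carr A"
  using A ar_e by (auto simp: in_variety_def is_alg_def)

lemma oper2_closed: "ar f = 2 \<Longrightarrow> x \<in> carr A \<Longrightarrow> y \<in> carr A \<Longrightarrow> oper A f [x, y] \<in> carr A"
  using A by (auto simp: in_variety_def is_alg_def)

lemmas term_intros = binary_term[OF ar_i] one_term terms_Var[OF UNIV_I]

lemma imp_refl: "x \<in> carr A \<Longrightarrow> oper A i [x, x] = oper A e []"
  using transfer_identity[OF A, of "App i [Var 0, Var 0]" "App e []" "\<lambda>_. x"]
  by (simp add: term_intros imp_refl_M)

lemma one_imp: "x \<in> carr A \<Longrightarrow> oper A i [oper A e [], x] = x"
  using transfer_identity[OF A, of "App i [App e [], Var 0]" "Var 0" "\<lambda>_. x"]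
  by (simp add: term_intros one_imp_M)

lemma imp_one: "x \<in> carr A \<Longrightarrow> oper A i [x, oper A e []] = oper A e []"
  using transfer_identity[OF A, of "App i [Var 0, App e []]" "App e []" "\<lambda>_. x"]
  by (simp add: term_intros imp_one_M)

lemma imp_trans:
  assumes "x \<in> carr A" "y \<in> carr A" "z \<in> carr A"
  shows "oper A i [oper A i [x, y], oper A i [oper A i [y, z], oper A i [x, z]]] = oper A e []"
  using assms transfer_identity[OF A,
      of "App i [App i [Var 0, Var 1], App i [App i [Var 1, Var 2], App i [Var 0, Var 2]]]"
        "App e []" "\<lambda>k. if k = 0 then x else if k = 1 then y else z"]
  by (simp add: term_intros imp_trans_M)

lemma cong1:
  assumes "ar f = 2" "x \<in> carr A" "y \<in> carr A" "z \<in> carr A"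
  shows "oper A i [oper A i [x, y], oper A i [oper A i [y, x],
           oper A i [oper A f [x, z], oper A f [y, z]]]] = oper A e []"
  using assms transfer_identity[OF A,
      of "App i [App i [Var 0, Var 1], App i [App i [Var 1, Var 0],
            App i [App f [Var 0, Var 2], App f [Var 1, Var 2]]]]"
        "App e []" "\<lambda>k. if k = 0 then x else if k = 1 then y else z"]
  by (simp add: term_intros binary_term cong1_M)

lemma cong2:
  assumes "ar f = 2" "x \<in> carr A" "y \<in> carr A" "z \<in> carr A"
  shows "oper A i [oper A i [x, y], oper A i [oper A i [y, x],
           oper A i [oper A f [z, x], oper A f [z, y]]]] = oper A e []"
  using assms transfer_identity[OF A,
      of "App i [App i [Var 0, Var 1], App i [App i [Var 1, Var 0],
            App i [App f [Var 2, Var 0], App f [Var 2, Var 1]]]]"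
        "App e []" "\<lambda>k. if k = 0 then x else if k = 1 then y else z"]
  by (simp add: term_intros binary_term cong2_M)

lemma alg_filter_if_implicative:
  assumes FA: "F \<subseteq> carr A" and one: "oper A e [] \<in> F"
    and mp: "\<And>a b. a \<in> F \<Longrightarrow> b \<in> carr A \<Longrightarrow> oper A i [a, b] \<in> F \<Longrightarrow> b \<in> F"
  shows "alg_filter ar e M A F"
proof -
  define R where "R a b \<longleftrightarrow> oper A i [a, b] \<in> F \<and> oper A i [b, a] \<in> F" for a b
  have algA: "is_alg ar A" using A by (simp add: in_variety_def)
  have R_refl: "R a a" if "a \<in> carr A" for a
    using that one by (simp add: R_def imp_refl)
  have R_sym: "R b a" if "R a b" for a b
    using that by (simp add: R_def)
  have F_trans: "oper A i [a, c] \<in> F"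
    if "oper A i [a, b] \<in> F" "oper A i [b, c] \<in> F" "a \<in> carr A" "b \<in> carr A" "c \<in> carr A" for a b c
    by (rule mp[OF that(2) _ mp[OF that(1)]])
       (simp_all add: that(3-) oper2_closed ar_i imp_trans one)
  have R_trans: "R a c" if "R a b" "R b c" "a \<in> carr A" "b \<in> carr A" "c \<in> carr A" for a b c
    using that F_trans unfolding R_def by blast
  have R_cong1: "R (oper A f [x, z]) (oper A f [y, z])"
    if "R x y" "ar f = 2" "x \<in> carr A" "y \<in> carr A" "z \<in> carr A" for f x y z
  proof -
    have "oper A i [oper A f [x, z], oper A f [y, z]] \<in> F"
      if "R x y" "x \<in> carr A" "y \<in> carr A" for x y
      by (rule mp[of "oper A i [y, x]", OF _ _ mp[of "oper A i [x, y]"]])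
         (use that \<open>ar f = 2\<close> \<open>z \<in> carr A\<close> in \<open>simp_all add: oper2_closed ar_i cong1 one R_def\<close>)
    then show ?thesis using that R_sym unfolding R_def by blast
  qed
  have R_cong2: "R (oper A f [z, x]) (oper A f [z, y])"
    if "R x y" "ar f = 2" "x \<in> carr A" "y \<in> carr A" "z \<in> carr A" for f x y z
  proof -
    have "oper A i [oper A f [z, x], oper A f [z, y]] \<in> F"
      if "R x y" "x \<in> carr A" "y \<in> carr A" for x y
      by (rule mp[of "oper A i [y, x]", OF _ _ mp[of "oper A i [x, y]"]])
         (use that \<open>ar f = 2\<close> \<open>z \<in> carr A\<close> in \<open>simp_all add: oper2_closed ar_i cong2 one R_def\<close>)
    then show ?thesis using that R_sym unfolding R_def by blast
  qed
  have R_oper: "R (oper A f xs) (oper A f ys)"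
    if len: "length xs = ar f" and R: "list_all2 R xs ys"
      and xs: "set xs \<subseteq> carr A" and ys: "set ys \<subseteq> carr A" for f xs ys
  proof (cases "ar f = 0")
    case True
    then show ?thesis using len R R_refl algA by (simp add: is_alg_def)
  next
    case False
    then have f: "ar f = 2" using ar_cases[of f] by simp
    then obtain x1 x2 y1 y2 where xy: "xs = [x1, x2]" "ys = [y1, y2]"
      using len R by (auto simp: numeral_2_eq_2 length_Suc_conv list_all2_Cons1)
    then show ?thesis
      using R xs ys f oper2_closed
      by (auto intro!: R_trans[OF R_cong1[of x1 y1 f x2] R_cong2[of x2 y2 f y1]])
  qed
  define h where "h a = {b \<in> carr A. R a b}" for a
  have h_eq: "h a = h b \<longleftrightarrow> R a b" if "a \<in> carr A" "b \<in> carr A" for a b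
    using that R_refl R_sym R_trans unfolding h_def by blast
  define rep where "rep C = (SOME a. a \<in> C)" for C :: "'a set"
  have rep: "rep (h a) \<in> carr A" "R a (rep (h a))" "h (rep (h a)) = h a" if "a \<in> carr A" for a
  proof -
    have "rep (h a) \<in> h a"
      unfolding rep_def by (rule someI[of _ a]) (use that R_refl in \<open>simp add: h_def\<close>)
    then show "rep (h a) \<in> carr A" "R a (rep (h a))" by (auto simp: h_def)
    then show "h (rep (h a)) = h a" using that h_eq by metis
  qed
  define B :: "('f, 'a set) alg"
    where "B = \<lparr>carr = h ` carr A, oper = (\<lambda>f Cs. h (oper A f (map rep Cs)))\<rparr>"
  have rep_B: "rep C \<in> carr A" if "C \<in> carr B" for C
    using that rep(1) by (auto simp: B_def)
  have algB: "is_alg ar B"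
  proof -
    have "oper B f Cs \<in> carr B" if "length Cs = ar f" "set Cs \<subseteq> carr B" for f Cs
    proof -
      have "set (map rep Cs) \<subseteq> carr A" using that rep_B by auto
      then have "oper A f (map rep Cs) \<in> carr A" using algA that(1) by (simp add: is_alg_def)
      then show ?thesis by (simp add: B_def)
    qed
    moreover have "carr B \<noteq> {}" using one_closed by (auto simp: B_def)
    ultimately show ?thesis by (simp add: is_alg_def)
  qed
  have hom: "alg_hom ar A B h"
  proof -
    have "h (oper A f xs) = oper B f (map h xs)" if "length xs = ar f" "set xs \<subseteq> carr A" for f xs
    proof -
      have ys: "set (map rep (map h xs)) \<subseteq> carr A" using that rep by auto
      have "list_all2 R xs (map rep (map h xs))"
        using that(2) by (auto simp: list_all2_map2 intro!: list.rel_refl_strong rep(2))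
      then have "R (oper A f xs) (oper A f (map rep (map h xs)))"
        using R_oper that ys by blast
      then show ?thesis using h_eq algA that ys by (simp add: B_def is_alg_def del: map_map)
    qed
    then show ?thesis by (simp add: alg_hom_def B_def)
  qed
  have "in_variety ar M B"
  proof -
    have "trm_val B v s = trm_val B v t"
      if s: "s \<in> terms ar UNIV" and t: "t \<in> terms ar UNIV" and st: "identity_holds M s t"
        and v: "\<forall>k. v k \<in> carr B" for s t v
    proof -
      have w: "rep (v k) \<in> carr A" "h (rep (v k)) = v k" for k
        using v[rule_format, of k] rep by (auto simp: B_def)
      have "identity_holds A s t" using A s t st by (simp add: in_variety_def)
      then have "trm_val A (\<lambda>k. rep (v k)) s = trm_val A (\<lambda>k. rep (v k)) t"
        using w by (simp add: identity_holds_def)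
      then show ?thesis
        using trm_val_hom[OF algA hom s, of "\<lambda>k. rep (v k)"]
          trm_val_hom[OF algA hom t, of "\<lambda>k. rep (v k)"] w by simp
    qed
    then show ?thesis using algB unfolding in_variety_def identity_holds_def by blast
  qed
  moreover have "F = {a \<in> carr A. h a = oper B e []}"
  proof -
    have "oper B e [] = h (oper A e [])" by (simp add: B_def)
    moreover have "R a (oper A e []) \<longleftrightarrow> a \<in> F" if "a \<in> carr A" for a
      using that one by (simp add: R_def imp_one one_imp)
    moreover have "h a = h (oper A e []) \<longleftrightarrow> R a (oper A e [])" if "a \<in> carr A" for a
      using h_eq that one_closed by blast
    ultimately show ?thesis using FA by auto
  qed
  ultimately show ?thesis using hom unfolding alg_filter_def by blast
qed

lemma alg_filter_iff_implicative:
  "alg_filter ar e M A F \<longleftrightarrow> F \<subseteq> carr A \<and> oper A e [] \<in> F \<and>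
     (\<forall>a\<in>F. \<forall>b\<in>carr A. oper A i [a, b] \<in> F \<longrightarrow> b \<in> F)"
  (is "_ \<longleftrightarrow> ?R")
proof
  assume "alg_filter ar e M A F"
  then obtain B :: "('f, 'a set) alg" and h where B: "in_variety ar M B" and h: "alg_hom ar A B h"
    and F: "F = {a \<in> carr A. h a = oper B e []}"
    unfolding alg_filter_def by blast
  have hB: "h a \<in> carr B" if "a \<in> carr A" for a
    using h that by (auto simp: alg_hom_def)
  have h1: "h (oper A e []) = oper B e []"
    using h ar_e by (auto simp: alg_hom_def)
  have h2: "h (oper A i [a, b]) = oper B i [h a, h b]" if "a \<in> carr A" "b \<in> carr A" for a b
    using h ar_i that by (auto simp: alg_hom_def)
  have hb: "oper B i [oper B e [], h b] = h b" if "b \<in> carr A" for b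
    using transfer_identity[OF B, of "App i [App e [], Var 0]" "Var 0" "\<lambda>_. h b"] hB[OF that]
    by (simp add: term_intros one_imp_M)
  have "b \<in> F" if "a \<in> F" "b \<in> carr A" "oper A i [a, b] \<in> F" for a b
    using that h2[of a b] hb[of b] unfolding F mem_Collect_eq by metis
  moreover have "F \<subseteq> carr A" "oper A e [] \<in> F" using one_closed h1 by (simp_all add: F)
  ultimately show ?R by blast
next
  assume R: ?R
  show "alg_filter ar e M A F"
  proof (rule alg_filter_if_implicative)
    show "b \<in> F" if "a \<in> F" "b \<in> carr A" "oper A i [a, b] \<in> F" for a b
      using R that by blast
  qed (use R in blast)+
qed

end

end

section \<open>Spectra with corresponding filters\<close>

lemma spec_points_pullback:
  fixes A :: "('f, 'a) alg" and B :: "('g, 'b) alg"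
  assumes \<alpha>: "\<And>a. a \<in> carr A \<Longrightarrow> \<alpha> a \<in> carr B"
    and \<beta>_filter: "\<And>F. alg_filter ar e M A F \<Longrightarrow> alg_filter ar' e' N B {b \<in> carr B. \<beta> b \<in> F}"
    and \<alpha>_filter: "\<And>G. alg_filter ar' e' N B G \<Longrightarrow> alg_filter ar e M A {a \<in> carr A. \<alpha> a \<in> G}"
    and \<beta>\<alpha>: "\<And>F a. alg_filter ar e M A F \<Longrightarrow> a \<in> carr A \<Longrightarrow> \<beta> (\<alpha> a) \<in> F \<longleftrightarrow> a \<in> F"
    and \<alpha>\<beta>: "\<And>G b. alg_filter ar' e' N B G \<Longrightarrow> b \<in> carr B \<Longrightarrow> \<alpha> (\<beta> b) \<in> G \<longleftrightarrow> b \<in> G"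
    and \<beta>: "\<And>b. b \<in> carr B \<Longrightarrow> \<beta> b \<in> carr A"
    and P: "P \<in> spec_points ar e M A"
  shows "{b \<in> carr B. \<beta> b \<in> P} \<in> spec_points ar' e' N B"
    and "{a \<in> carr A. \<alpha> a \<in> {b \<in> carr B. \<beta> b \<in> P}} = P"
proof -
  have fP: "alg_filter ar e M A P"
    and prime: "\<And>F G. \<lbrakk>alg_filter ar e M A F; alg_filter ar e M A G; F \<inter> G \<subseteq> P\<rbrakk> \<Longrightarrow>
                  F \<subseteq> P \<or> G \<subseteq> P"
    and proper: "P \<noteq> carr A"
    using P by (auto simp: spec_points_def prime_filter_def)
  have PA: "P \<subseteq> carr A" using fP by (auto simp: alg_filter_def)
  show pullback: "{a \<in> carr A. \<alpha> a \<in> {b \<in> carr B. \<beta> b \<in> P}} = P"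
    using \<beta>\<alpha>[OF fP] \<alpha> PA by blast
  have "F \<subseteq> {b \<in> carr B. \<beta> b \<in> P} \<or> G \<subseteq> {b \<in> carr B. \<beta> b \<in> P}"
    if F: "alg_filter ar' e' N B F" and G: "alg_filter ar' e' N B G"
      and FG: "F \<inter> G \<subseteq> {b \<in> carr B. \<beta> b \<in> P}" for F G
  proof -
    have "{a \<in> carr A. \<alpha> a \<in> F} \<inter> {a \<in> carr A. \<alpha> a \<in> G} \<subseteq> P" using FG pullback by blast
    then have *: "{a \<in> carr A. \<alpha> a \<in> F} \<subseteq> P \<or> {a \<in> carr A. \<alpha> a \<in> G} \<subseteq> P"
      using prime \<alpha>_filter F G by blast
    have "H \<subseteq> {b \<in> carr B. \<beta> b \<in> P}"
      if H: "alg_filter ar' e' N B H" "{a \<in> carr A. \<alpha> a \<in> H} \<subseteq> P" for H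
    proof
      fix b assume b: "b \<in> H"
      then have "b \<in> carr B" using H(1) by (auto simp: alg_filter_def)
      then show "b \<in> {b \<in> carr B. \<beta> b \<in> P}" using \<alpha>\<beta>[OF H(1)] \<beta> H(2) b by blast
    qed
    then show ?thesis using * F G by blast
  qed
  moreover have "{b \<in> carr B. \<beta> b \<in> P} \<noteq> carr B" using pullback \<alpha> proper by blast
  ultimately show "{b \<in> carr B. \<beta> b \<in> P} \<in> spec_points ar' e' N B"
    using \<beta>_filter[OF fP] by (simp add: spec_points_def prime_filter_def)
qed

lemma continuous_map_Spec:
  assumes "\<And>P. P \<in> spec_points ar e M A \<Longrightarrow> \<phi> P \<in> spec_points ar' e' N B"
    and "\<And>b. b \<in> carr B \<Longrightarrow> \<beta> b \<in> carr A"
    and "\<And>P b. P \<in> spec_points ar e M A \<Longrightarrow> b \<in> carr B \<Longrightarrow> b \<in> \<phi> P \<longleftrightarrow> \<beta> b \<in> P"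
  shows "continuous_map (Spec ar e M A) (Spec ar' e' N B) \<phi>"
  unfolding Spec_def[of ar' e' N B]
proof (rule continuous_on_generated_topo)
  fix U assume "U \<in> (\<lambda>b. {P \<in> spec_points ar' e' N B. b \<notin> P}) ` carr B"
  then obtain b where b: "b \<in> carr B" "U = {P \<in> spec_points ar' e' N B. b \<notin> P}" by blast
  then have "\<phi> -` U \<inter> topspace (Spec ar e M A) = {P \<in> spec_points ar e M A. \<beta> b \<notin> P}"
    using assms by (auto simp: topspace_Spec)
  then show "openin (Spec ar e M A) (\<phi> -` U \<inter> topspace (Spec ar e M A))"
    using assms(2) b by (auto simp: Spec_def intro!: topology_generated_by_Basis)
next
  show "\<phi> ` topspace (Spec ar e M A) \<subseteq> \<Union> ((\<lambda>b. {P \<in> spec_points ar' e' N B. b \<notin> P}) ` carr B)"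
    using assms(1) topspace_Spec[of ar' e' N B] by (auto simp: topspace_Spec Spec_def)
qed

lemma Spec_homeomorphic:
  fixes A :: "('f, 'a) alg" and B :: "('g, 'b) alg"
  assumes \<alpha>: "\<And>a. a \<in> carr A \<Longrightarrow> \<alpha> a \<in> carr B"
    and \<beta>: "\<And>b. b \<in> carr B \<Longrightarrow> \<beta> b \<in> carr A"
    and \<beta>_filter: "\<And>F. alg_filter ar e M A F \<Longrightarrow> alg_filter ar' e' N B {b \<in> carr B. \<beta> b \<in> F}"
    and \<alpha>_filter: "\<And>G. alg_filter ar' e' N B G \<Longrightarrow> alg_filter ar e M A {a \<in> carr A. \<alpha> a \<in> G}"
    and \<beta>\<alpha>: "\<And>F a. alg_filter ar e M A F \<Longrightarrow> a \<in> carr A \<Longrightarrow> \<beta> (\<alpha> a) \<in> F \<longleftrightarrow> a \<in> F"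
    and \<alpha>\<beta>: "\<And>G b. alg_filter ar' e' N B G \<Longrightarrow> b \<in> carr B \<Longrightarrow> \<alpha> (\<beta> b) \<in> G \<longleftrightarrow> b \<in> G"
  shows "Spec ar e M A homeomorphic_space Spec ar' e' N B"
proof -
  note fwd = spec_points_pullback[OF \<alpha> \<beta>_filter \<alpha>_filter \<beta>\<alpha> \<alpha>\<beta> \<beta>]
  note bwd = spec_points_pullback[OF \<beta> \<alpha>_filter \<beta>_filter \<alpha>\<beta> \<beta>\<alpha> \<alpha>]
  have "continuous_map (Spec ar e M A) (Spec ar' e' N B) (\<lambda>P. {b \<in> carr B. \<beta> b \<in> P})"
    using fwd(1) \<beta> by (intro continuous_map_Spec[where \<beta> = \<beta>]) auto
  moreover have "continuous_map (Spec ar' e' N B) (Spec ar e M A) (\<lambda>Q. {a \<in> carr A. \<alpha> a \<in> Q})"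
    using bwd(1) \<alpha> by (intro continuous_map_Spec[where \<beta> = \<alpha>]) auto
  ultimately show ?thesis
    unfolding homeomorphic_space_def homeomorphic_maps_def topspace_Spec
    by (intro exI conjI ballI) (assumption | rule fwd(2) bwd(2))+
qed

section \<open>Additive copies of the generators\<close>

fun add_hoop_oper :: "hoop_op \<Rightarrow> real list \<Rightarrow> real" where
  "add_hoop_oper HMul [a, b] = a + b"
| "add_hoop_oper HImp [a, b] = max 0 (b - a)"
| "add_hoop_oper HOne [] = 0"

definition add_hoop :: "(hoop_op, real) alg" where
  "add_hoop = \<lparr>carr = {0..}, oper = add_hoop_oper\<rparr>"

fun add_mv_oper :: "mv_op \<Rightarrow> real list \<Rightarrow> real" where
  "add_mv_oper MVMul [a, b] = min 1 (a + b)"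
| "add_mv_oper MVImp [a, b] = max 0 (b - a)"
| "add_mv_oper MVZero [] = 1"
| "add_mv_oper MVOne [] = 0"

definition add_mv :: "(mv_op, real) alg" where
  "add_mv = \<lparr>carr = {0..1}, oper = add_mv_oper\<rparr>"

lemma add_hoop_simps [simp]:
  "carr add_hoop = {0..}" "oper add_hoop HMul [a, b] = a + b"
  "oper add_hoop HImp [a, b] = max 0 (b - a)" "oper add_hoop HOne [] = 0"
  by (simp_all add: add_hoop_def)

lemma add_mv_simps [simp]:
  "carr add_mv = {0..1}" "oper add_mv MVMul [a, b] = min 1 (a + b)"
  "oper add_mv MVImp [a, b] = max 0 (b - a)" "oper add_mv MVZero [] = 1"
  "oper add_mv MVOne [] = 0"
  by (simp_all add: add_mv_def)

lemma is_alg_add_hoop: "is_alg hoop_ar add_hoop"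
proof -
  have "oper add_hoop f xs \<in> carr add_hoop"
    if "length xs = hoop_ar f" "set xs \<subseteq> carr add_hoop" for f xs
    using that by (cases f) (auto simp: length_Suc_conv numeral_2_eq_2)
  then show ?thesis by (auto simp: is_alg_def)
qed

lemma is_alg_add_mv: "is_alg mv_ar add_mv"
proof -
  have "oper add_mv f xs \<in> carr add_mv"
    if "length xs = mv_ar f" "set xs \<subseteq> carr add_mv" for f xs
    using that by (cases f) (auto simp: length_Suc_conv numeral_2_eq_2)
  then show ?thesis by (auto simp: is_alg_def)
qed

lemma add_hoop_hom: "alg_hom hoop_ar add_hoop product_alg (\<lambda>x. exp (- x))"
proof -
  have "exp (- max 0 (b - a)) = min 1 (exp (- b) / exp (- a))" for a b :: real
    by (cases "a \<le> b") (auto simp: min_def simp flip: exp_diff)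
  then have "exp (- oper add_hoop f xs) = oper product_alg f (map (\<lambda>x. exp (- x)) xs)"
    if "length xs = hoop_ar f" for f xs
    using that
    by (cases f) (auto simp: length_Suc_conv numeral_2_eq_2 product_alg_def mult_exp_exp)
  then show ?thesis by (auto simp: alg_hom_def product_alg_def)
qed

lemma add_hoop_bij: "bij_betw (\<lambda>x. exp (- x)) (carr add_hoop) (carr product_alg)"
  by (rule bij_betw_byWitness[where f' = "\<lambda>y. - ln y"]) (auto simp: product_alg_def)

lemma add_mv_hom: "alg_hom mv_ar add_mv lukasiewicz_alg (\<lambda>x. 1 - x)"
proof -
  have "1 - oper add_mv f xs = oper lukasiewicz_alg f (map (\<lambda>x. 1 - x) xs)"
    if "length xs = mv_ar f" for f xs
    using that
    by (cases f) (auto simp: length_Suc_conv numeral_2_eq_2 lukasiewicz_alg_def min_def max_def)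
  then show ?thesis by (auto simp: alg_hom_def lukasiewicz_alg_def)
qed

lemma add_mv_bij: "bij_betw (\<lambda>x. 1 - x) (carr add_mv) (carr lukasiewicz_alg)"
  by (rule bij_betw_byWitness[where f' = "\<lambda>y. 1 - y"]) (auto simp: lukasiewicz_alg_def)

lemma hoop_terms_induct [consumes 1, case_names Var Mul Imp One]:
  assumes t: "t \<in> terms hoop_ar X"
    and "\<And>i. i \<in> X \<Longrightarrow> P (Var i)"
    and "\<And>s t. \<lbrakk>s \<in> terms hoop_ar X; t \<in> terms hoop_ar X; P s; P t\<rbrakk> \<Longrightarrow> P (App HMul [s, t])"
    and "\<And>s t. \<lbrakk>s \<in> terms hoop_ar X; t \<in> terms hoop_ar X; P s; P t\<rbrakk> \<Longrightarrow> P (App HImp [s, t])"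
    and "P (App HOne [])"
  shows "P t"
  using t
proof (induction rule: terms.induct)
  case (terms_App ts f)
  then show ?case
    using assms by (cases f) (auto simp: length_Suc_conv numeral_2_eq_2)
qed (use assms in blast)

lemma mv_terms_induct [consumes 1, case_names Var Mul Imp Zero One]:
  assumes t: "t \<in> terms mv_ar X"
    and "\<And>i. i \<in> X \<Longrightarrow> P (Var i)"
    and "\<And>s t. \<lbrakk>s \<in> terms mv_ar X; t \<in> terms mv_ar X; P s; P t\<rbrakk> \<Longrightarrow> P (App MVMul [s, t])"
    and "\<And>s t. \<lbrakk>s \<in> terms mv_ar X; t \<in> terms mv_ar X; P s; P t\<rbrakk> \<Longrightarrow> P (App MVImp [s, t])"
    and "P (App MVZero [])" and "P (App MVOne [])"
  shows "P t"
  using t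
proof (induction rule: terms.induct)
  case (terms_App ts f)
  then show ?case
    using assms by (cases f) (auto simp: length_Suc_conv numeral_2_eq_2)
qed (use assms in blast)

lemma hoop_terms_intros:
  "i \<in> X \<Longrightarrow> Var i \<in> terms hoop_ar X"
  "s \<in> terms hoop_ar X \<Longrightarrow> t \<in> terms hoop_ar X \<Longrightarrow> App HMul [s, t] \<in> terms hoop_ar X"
  "s \<in> terms hoop_ar X \<Longrightarrow> t \<in> terms hoop_ar X \<Longrightarrow> App HImp [s, t] \<in> terms hoop_ar X"
  "App HOne [] \<in> terms hoop_ar X"
  by (auto intro!: terms.intros)

lemma mv_terms_intros:
  "i \<in> X \<Longrightarrow> Var i \<in> terms mv_ar X"
  "s \<in> terms mv_ar X \<Longrightarrow> t \<in> terms mv_ar X \<Longrightarrow> App MVMul [s, t] \<in> terms mv_ar X"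
  "s \<in> terms mv_ar X \<Longrightarrow> t \<in> terms mv_ar X \<Longrightarrow> App MVImp [s, t] \<in> terms mv_ar X"
  "App MVZero [] \<in> terms mv_ar X" "App MVOne [] \<in> terms mv_ar X"
  by (auto intro!: terms.intros)

section \<open>The strong unit and homogenization of MV-terms\<close>

fun coord_max :: "nat \<Rightarrow> (nat \<Rightarrow> real) \<Rightarrow> real" where
  "coord_max 0 x = 0"
| "coord_max (Suc k) x = max (coord_max k x) (x k)"

fun coord_max_trm :: "nat \<Rightarrow> hoop_op trm" where
  "coord_max_trm 0 = App HOne []"
| "coord_max_trm (Suc k) = App HMul [coord_max_trm k, App HImp [coord_max_trm k, Var k]]"

definition unit_trm :: "nat \<Rightarrow> hoop_op trm" where
  "unit_trm d = App HMul [Var d, coord_max_trm d]"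

definition meet_trm :: "hoop_op trm \<Rightarrow> hoop_op trm \<Rightarrow> hoop_op trm" where
  "meet_trm s t = App HImp [App HImp [t, s], s]"

fun homog_trm :: "nat \<Rightarrow> mv_op trm \<Rightarrow> hoop_op trm" where
  "homog_trm d (Var i) = Var i"
| "homog_trm d (App MVMul [s, t]) =
     meet_trm (unit_trm d) (App HMul [homog_trm d s, homog_trm d t])"
| "homog_trm d (App MVImp [s, t]) = App HImp [homog_trm d s, homog_trm d t]"
| "homog_trm d (App MVZero _) = unit_trm d"
| "homog_trm d (App _ _) = App HOne []"

definition hoop_unit :: "nat \<Rightarrow> (nat \<Rightarrow> real) \<Rightarrow> real" where
  "hoop_unit d x = x d + coord_max d x"

lemma coord_max_nonneg: "0 \<le> coord_max k x"
  by (induction k) auto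

lemma coord_max_ge: "i < k \<Longrightarrow> x i \<le> coord_max k x"
  by (induction k) (auto simp: less_Suc_eq le_max_iff_disj)

lemma coord_max_le: "0 \<le> c \<Longrightarrow> (\<And>i. i < k \<Longrightarrow> x i \<le> c) \<Longrightarrow> coord_max k x \<le> c"
  by (induction k) auto

lemma coord_max_cong: "(\<And>i. i < k \<Longrightarrow> x i = y i) \<Longrightarrow> coord_max k x = coord_max k y"
  by (induction k) auto

lemma trm_val_coord_max: "trm_val add_hoop x (coord_max_trm k) = coord_max k x"
  by (induction k) auto

lemma trm_val_unit: "trm_val add_hoop x (unit_trm d) = hoop_unit d x"
  by (simp add: unit_trm_def hoop_unit_def trm_val_coord_max)

lemma coord_max_trm_terms: "k \<le> n \<Longrightarrow> coord_max_trm k \<in> terms hoop_ar {..<n}"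
  by (induction k) (auto intro!: hoop_terms_intros)

lemma unit_trm_terms: "unit_trm d \<in> terms hoop_ar {..<Suc d}"
  by (auto simp: unit_trm_def intro!: hoop_terms_intros coord_max_trm_terms)

lemma homog_trm_terms: "t \<in> terms mv_ar {..<d} \<Longrightarrow> homog_trm d t \<in> terms hoop_ar {..<Suc d}"
  by (induction rule: mv_terms_induct)
     (auto simp: meet_trm_def intro!: hoop_terms_intros unit_trm_terms)

lemma hoop_val_nonneg:
  "t \<in> terms hoop_ar X \<Longrightarrow> (\<And>i. i \<in> X \<Longrightarrow> 0 \<le> x i) \<Longrightarrow> 0 \<le> trm_val add_hoop x t"
  using trm_val_closed[OF is_alg_add_hoop, of t X x] by simp

lemma mv_val_bounds:
  assumes "t \<in> terms mv_ar X" "\<And>i. i \<in> X \<Longrightarrow> y i \<in> {0..1}"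
  shows "0 \<le> trm_val add_mv y t" "trm_val add_mv y t \<le> 1"
  using trm_val_closed[OF is_alg_add_mv, of t X y] assms by auto

lemma hoop_val_scale:
  assumes "t \<in> terms hoop_ar X" "0 \<le> c"
  shows "trm_val add_hoop (\<lambda>i. c * x i) t = c * trm_val add_hoop x t"
  using assms(1)
  by (induction rule: hoop_terms_induct)
     (use assms(2) in \<open>auto simp: distrib_left max_mult_distrib_left right_diff_distrib\<close>)

lemma trm_val_meet:
  "0 \<le> trm_val add_hoop x s \<Longrightarrow> 0 \<le> trm_val add_hoop x t \<Longrightarrow>
   trm_val add_hoop x (meet_trm s t) = min (trm_val add_hoop x s) (trm_val add_hoop x t)"
  by (auto simp: meet_trm_def)

lemma trm_val_homog:
  assumes t: "t \<in> terms mv_ar {..<d}" and x: "\<And>i. 0 \<le> x i" and y: "\<And>i. y i \<in> {0..1}"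
    and xy: "\<And>i. i < d \<Longrightarrow> x i = hoop_unit d x * y i"
  shows "trm_val add_hoop x (homog_trm d t) = hoop_unit d x * trm_val add_mv y t"
  using t
proof (induction rule: mv_terms_induct)
  case (Mul s t)
  have u: "0 \<le> hoop_unit d x"
    using x coord_max_nonneg by (simp add: hoop_unit_def)
  have "min c (c * a + c * b) = c * min 1 (a + b)" if "0 \<le> c" for a b c :: real
    using that by (simp add: min_mult_distrib_left distrib_left)
  moreover have "0 \<le> trm_val add_mv y s" "0 \<le> trm_val add_mv y t"
    using mv_val_bounds Mul y by blast+
  ultimately show ?case
    using Mul u by (simp add: trm_val_meet trm_val_unit)
next
  case (Imp s t)
  have "0 \<le> hoop_unit d x"
    using x coord_max_nonneg by (simp add: hoop_unit_def)
  then show ?case using Imp by (simp add: max_mult_distrib_left right_diff_distrib)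
qed (simp_all add: xy trm_val_unit)

lemma hoop_val_le_unit:
  assumes "s \<in> terms hoop_ar {..<Suc d}"
  shows "\<exists>m. \<forall>x. (\<forall>i. 0 \<le> x i) \<longrightarrow> trm_val add_hoop x s \<le> real m * hoop_unit d x"
  using assms
proof (induction rule: hoop_terms_induct)
  case (Var i)
  have "x i \<le> hoop_unit d x" if "\<forall>i. 0 \<le> x i" for x
  proof (cases "i = d")
    case False
    then have "x i \<le> coord_max d x" using Var coord_max_ge by simp
    then show ?thesis using that by (simp add: hoop_unit_def add_increasing)
  qed (simp add: hoop_unit_def coord_max_nonneg)
  then show ?case by (intro exI[of _ 1]) simp
next
  case (Mul s t)
  then obtain m k where
    "\<forall>x. (\<forall>i. 0 \<le> x i) \<longrightarrow> trm_val add_hoop x s \<le> real m * hoop_unit d x"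
    "\<forall>x. (\<forall>i. 0 \<le> x i) \<longrightarrow> trm_val add_hoop x t \<le> real k * hoop_unit d x"
    by blast
  then show ?case
    by (intro exI[of _ "m + k"]) (simp add: distrib_right add_mono)
next
  case (Imp s t)
  then obtain k where k: "\<forall>x. (\<forall>i. 0 \<le> x i) \<longrightarrow> trm_val add_hoop x t \<le> real k * hoop_unit d x"
    by blast
  have "max 0 (trm_val add_hoop x t - trm_val add_hoop x s) \<le> real k * hoop_unit d x"
    if x: "\<forall>i. 0 \<le> x i" for x
  proof -
    have "0 \<le> trm_val add_hoop x s" "0 \<le> trm_val add_hoop x t"
      using hoop_val_nonneg[OF Imp(1)] hoop_val_nonneg[OF Imp(2)] x by blast+
    moreover have "trm_val add_hoop x t \<le> real k * hoop_unit d x" using k x by blast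
    ultimately show ?thesis by linarith
  qed
  then show ?case by (intro exI[of _ k]) simp
next
  case One
  show ?case by (intro exI[of _ 0]) simp
qed

section \<open>Dehomogenization of hoop terms\<close>

definition dehomog :: "nat \<Rightarrow> (nat \<Rightarrow> real) \<Rightarrow> nat \<Rightarrow> real" where
  "dehomog d y i = (if i < d then y i else 1 - coord_max d y)"

lemma hoop_unit_dehomog: "hoop_unit d (dehomog d y) = 1"
  using coord_max_cong[of d "dehomog d y" y] by (simp add: hoop_unit_def dehomog_def)

lemma dehomog_nonneg: "(\<And>i. y i \<in> {0..1}) \<Longrightarrow> 0 \<le> dehomog d y i"
  using coord_max_le[of 1 d y] by (auto simp: dehomog_def)

definition mv_definable :: "nat \<Rightarrow> ((nat \<Rightarrow> real) \<Rightarrow> real) \<Rightarrow> bool" where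
  "mv_definable d h \<longleftrightarrow>
     (\<exists>t\<in>terms mv_ar {..<d}. \<forall>y. (\<forall>i. y i \<in> {0..1}) \<longrightarrow> trm_val add_mv y t = h y)"

definition clip :: "real \<Rightarrow> real" where
  "clip a = max 0 (min 1 a)"

lemma mv_definable_cong:
  assumes "mv_definable d h" and eq: "\<And>y. (\<And>i. y i \<in> {0..1}) \<Longrightarrow> h y = g y"
  shows "mv_definable d g"
proof -
  obtain t where t: "t \<in> terms mv_ar {..<d}"
    and "\<And>y. \<forall>i. y i \<in> {0..1} \<Longrightarrow> trm_val add_mv y t = h y"
    using assms(1) unfolding mv_definable_def by blast
  then have "\<forall>y. (\<forall>i. y i \<in> {0..1}) \<longrightarrow> trm_val add_mv y t = g y"
    using eq by (metis (no_types))
  then show ?thesis using t unfolding mv_definable_def by blast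
qed

lemma mv_definable_0: "mv_definable d (\<lambda>_. 0)"
  unfolding mv_definable_def by (intro bexI[of _ "App MVOne []"]) (simp_all add: mv_terms_intros)

lemma mv_definable_1: "mv_definable d (\<lambda>_. 1)"
  unfolding mv_definable_def by (intro bexI[of _ "App MVZero []"]) (simp_all add: mv_terms_intros)

lemma mv_definable_Var: "i < d \<Longrightarrow> mv_definable d (\<lambda>y. y i)"
  unfolding mv_definable_def by (intro bexI[of _ "Var i"]) (simp_all add: mv_terms_intros)

lemma mv_definable_add:
  assumes "mv_definable d g" "mv_definable d h"
  shows "mv_definable d (\<lambda>y. min 1 (g y + h y))"
proof -
  obtain s t where "s \<in> terms mv_ar {..<d}" "t \<in> terms mv_ar {..<d}"
    "\<forall>y. (\<forall>i. y i \<in> {0..1}) \<longrightarrow> trm_val add_mv y s = g y"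
    "\<forall>y. (\<forall>i. y i \<in> {0..1}) \<longrightarrow> trm_val add_mv y t = h y"
    using assms unfolding mv_definable_def by blast
  then show ?thesis unfolding mv_definable_def
    by (intro bexI[of _ "App MVMul [s, t]"]) (simp_all add: mv_terms_intros)
qed

lemma mv_definable_diff:
  assumes "mv_definable d g" "mv_definable d h"
  shows "mv_definable d (\<lambda>y. max 0 (g y - h y))"
proof -
  obtain s t where "s \<in> terms mv_ar {..<d}" "t \<in> terms mv_ar {..<d}"
    "\<forall>y. (\<forall>i. y i \<in> {0..1}) \<longrightarrow> trm_val add_mv y s = g y"
    "\<forall>y. (\<forall>i. y i \<in> {0..1}) \<longrightarrow> trm_val add_mv y t = h y"
    using assms unfolding mv_definable_def by blast
  then show ?thesis unfolding mv_definable_def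
    by (intro bexI[of _ "App MVImp [t, s]"]) (simp_all add: mv_terms_intros)
qed

text \<open>\<open>levels d\<close> consists of the functions all of whose slices \<open>clip (h - k)\<close> are MV-term functions.
  It is not obviously closed under addition, but its additive stabilizer \<open>pl_group d\<close> is a
  lattice-ordered group for trivial reasons, and it contains the coordinates.\<close>

definition levels :: "nat \<Rightarrow> ((nat \<Rightarrow> real) \<Rightarrow> real) set" where
  "levels d = {h. \<forall>k::int. mv_definable d (\<lambda>y. clip (h y - of_int k))}"

definition pl_group :: "nat \<Rightarrow> ((nat \<Rightarrow> real) \<Rightarrow> real) set" where
  "pl_group d = {f. \<forall>h\<in>levels d. (\<lambda>y. h y + f y) \<in> levels d \<and> (\<lambda>y. h y - f y) \<in> levels d}"

lemma levels_0: "(\<lambda>_. 0) \<in> levels d"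
proof -
  have "mv_definable d (\<lambda>y. clip (0 - of_int k))" for k :: int
  proof (cases "k < 0")
    case True
    then have "of_int k \<le> (-1 :: real)" by linarith
    then show ?thesis using mv_definable_1 by (simp add: clip_def)
  qed (use mv_definable_0 in \<open>simp add: clip_def\<close>)
  then show ?thesis by (simp add: levels_def)
qed

lemma levels_shift:
  assumes "h \<in> levels d"
  shows "(\<lambda>y. h y + of_int m) \<in> levels d"
proof -
  have "mv_definable d (\<lambda>y. clip (h y - of_int (k - m)))" for k
    using assms unfolding levels_def by blast
  then show ?thesis by (simp add: levels_def algebra_simps)
qed

lemma levels_uminus:
  assumes "h \<in> levels d"
  shows "(\<lambda>y. - h y) \<in> levels d"
proof -
  have "mv_definable d (\<lambda>y. clip (- h y - of_int k))" for k :: int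
  proof -
    have "mv_definable d (\<lambda>y. clip (h y - of_int (- k - 1)))"
      using assms unfolding levels_def by blast
    then have "mv_definable d (\<lambda>y. max 0 (1 - clip (h y - of_int (- k - 1))))"
      by (rule mv_definable_diff[OF mv_definable_1])
    then show ?thesis by (rule mv_definable_cong) (auto simp: clip_def)
  qed
  then show ?thesis by (simp add: levels_def)
qed

lemma clip_max: "clip (max a b - c) = min 1 (clip (a - c) + max 0 (clip (b - c) - clip (a - c)))"
  by (auto simp: clip_def min_def max_def)

lemma levels_max:
  assumes "g \<in> levels d" "h \<in> levels d"
  shows "(\<lambda>y. max (g y) (h y)) \<in> levels d"
proof -
  have "mv_definable d (\<lambda>y. clip (max (g y) (h y) - of_int k))" for k :: int
  proof -
    have g: "mv_definable d (\<lambda>y. clip (g y - of_int k))"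
      and h: "mv_definable d (\<lambda>y. clip (h y - of_int k))"
      using assms unfolding levels_def by blast+
    show ?thesis
      by (rule mv_definable_cong[OF mv_definable_add[OF g mv_definable_diff[OF h g]]])
         (simp add: clip_max)
  qed
  then show ?thesis by (simp add: levels_def)
qed

lemma clip_add:
  "0 \<le> b \<Longrightarrow> b \<le> 1 \<Longrightarrow> clip (a + b) = max 0 (min 1 (clip a + b) - max 0 (1 - clip (a + 1)))"
  unfolding clip_def by (auto simp: min_def max_def)

lemma levels_add_Var:
  assumes "h \<in> levels d" "i < d"
  shows "(\<lambda>y. h y + y i) \<in> levels d"
proof -
  have "mv_definable d (\<lambda>y. clip (h y + y i - of_int k))" for k :: int
  proof -
    have 1: "mv_definable d (\<lambda>y. clip (h y - of_int k))"
      and 2: "mv_definable d (\<lambda>y. clip (h y - of_int (k - 1)))"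
      using assms(1) unfolding levels_def by blast+
    show ?thesis
    proof (rule mv_definable_cong[OF mv_definable_diff[OF
            mv_definable_add[OF 1 mv_definable_Var[OF assms(2)]]
            mv_definable_diff[OF mv_definable_1 2]]])
      fix y :: "nat \<Rightarrow> real" assume "\<And>i. y i \<in> {0..1}"
      then have "0 \<le> y i" "y i \<le> 1" by auto
      moreover have "h y - of_int (k - 1) = h y - of_int k + 1"
        "h y + y i - of_int k = h y - of_int k + y i" by simp_all
      ultimately show "max 0 (min 1 (clip (h y - of_int k) + y i) -
          max 0 (1 - clip (h y - of_int (k - 1)))) = clip (h y + y i - of_int k)"
        using clip_add[of "y i" "h y - of_int k"] by (simp only:)
    qed
  qed
  then show ?thesis by (simp add: levels_def)
qed

lemma pl_group_levels: "f \<in> pl_group d \<Longrightarrow> f \<in> levels d"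
  using levels_0 unfolding pl_group_def by fastforce

lemma pl_group_0: "(\<lambda>_. 0) \<in> pl_group d"
  by (simp add: pl_group_def)

lemma pl_group_1: "(\<lambda>_. 1) \<in> pl_group d"
  using levels_shift[of _ d 1] levels_shift[of _ d "- 1"] by (simp add: pl_group_def)

lemma pl_group_Var:
  assumes "i < d"
  shows "(\<lambda>y. y i) \<in> pl_group d"
proof -
  have "(\<lambda>y. h y - y i) \<in> levels d" if "h \<in> levels d" for h
    using levels_uminus[OF levels_add_Var[OF levels_uminus[OF that] assms]]
    by (simp add: algebra_simps)
  then show ?thesis using levels_add_Var assms by (simp add: pl_group_def)
qed

lemma pl_group_add:
  assumes "f \<in> pl_group d" "g \<in> pl_group d"
  shows "(\<lambda>y. f y + g y) \<in> pl_group d"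
proof -
  have "(\<lambda>y. h y + (f y + g y)) \<in> levels d \<and> (\<lambda>y. h y - (f y + g y)) \<in> levels d"
    if "h \<in> levels d" for h
  proof -
    have "(\<lambda>y. h y + f y) \<in> levels d" "(\<lambda>y. h y - f y) \<in> levels d"
      using assms(1) that by (auto simp: pl_group_def)
    then have "(\<lambda>y. h y + f y + g y) \<in> levels d" "(\<lambda>y. h y - f y - g y) \<in> levels d"
      using assms(2) by (auto simp: pl_group_def)
    then show ?thesis by (simp add: algebra_simps)
  qed
  then show ?thesis by (simp add: pl_group_def)
qed

lemma pl_group_uminus: "f \<in> pl_group d \<Longrightarrow> (\<lambda>y. - f y) \<in> pl_group d"
  by (simp add: pl_group_def)

lemma pl_group_diff: "f \<in> pl_group d \<Longrightarrow> g \<in> pl_group d \<Longrightarrow> (\<lambda>y. f y - g y) \<in> pl_group d"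
  using pl_group_add[OF _ pl_group_uminus, of f d g] by simp

lemma pl_group_max:
  assumes "f \<in> pl_group d" "g \<in> pl_group d"
  shows "(\<lambda>y. max (f y) (g y)) \<in> pl_group d"
proof -
  have "(\<lambda>y. h y + max (f y) (g y)) \<in> levels d \<and> (\<lambda>y. h y - max (f y) (g y)) \<in> levels d"
    if h: "h \<in> levels d" for h
  proof
    have "(\<lambda>y. h y + f y) \<in> levels d" "(\<lambda>y. h y + g y) \<in> levels d"
      using assms h by (auto simp: pl_group_def)
    from levels_max[OF this] show "(\<lambda>y. h y + max (f y) (g y)) \<in> levels d"
      by (simp add: max_add_distrib_right)
    have "(\<lambda>y. - h y + f y) \<in> levels d" "(\<lambda>y. - h y + g y) \<in> levels d"
      using assms levels_uminus[OF h] by (auto simp: pl_group_def)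
    moreover have "- max (- h y + f y) (- h y + g y) = h y - max (f y) (g y)" for y
      by (simp add: max_def)
    ultimately show "(\<lambda>y. h y - max (f y) (g y)) \<in> levels d"
      using levels_uminus[OF levels_max, of "\<lambda>y. - h y + f y" d "\<lambda>y. - h y + g y"] by simp
  qed
  then show ?thesis by (simp add: pl_group_def)
qed

lemma pl_group_coord_max: "k \<le> d \<Longrightarrow> coord_max k \<in> pl_group d"
proof (induction k)
  case 0
  have "coord_max 0 = (\<lambda>_. 0)" by auto
  then show ?case using pl_group_0 by simp
next
  case (Suc k)
  have "coord_max (Suc k) = (\<lambda>y. max (coord_max k y) (y k))" by auto
  then show ?case using pl_group_max[OF _ pl_group_Var, of "coord_max k" d k] Suc by simp
qed

lemma pl_group_dehomog:
  assumes "s \<in> terms hoop_ar {..<Suc d}"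
  shows "(\<lambda>y. trm_val add_hoop (dehomog d y) s) \<in> pl_group d"
  using assms
proof (induction rule: hoop_terms_induct)
  case (Var i)
  then show ?case
    using pl_group_Var pl_group_diff[OF pl_group_1 pl_group_coord_max, of d d]
    by (cases "i < d") (simp_all add: dehomog_def)
next
  case (Imp s t)
  then show ?case using pl_group_max[OF pl_group_0 pl_group_diff] by simp
qed (simp_all add: pl_group_0 pl_group_add)

lemma dehomog_trm_exists:
  assumes s: "s \<in> terms hoop_ar {..<Suc d}"
  shows "\<exists>t\<in>terms mv_ar {..<d}. \<forall>y. (\<forall>i. y i \<in> {0..1}) \<longrightarrow>
           trm_val add_mv y t = min 1 (trm_val add_hoop (dehomog d y) s)"
proof -
  have "mv_definable d (\<lambda>y. clip (trm_val add_hoop (dehomog d y) s - of_int 0))"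
    using pl_group_levels[OF pl_group_dehomog[OF s]] unfolding levels_def by blast
  moreover have "0 \<le> trm_val add_hoop (dehomog d y) s" if "\<And>i. y i \<in> {0..1}" for y
    by (intro hoop_val_nonneg[OF s] dehomog_nonneg that)
  ultimately have "mv_definable d (\<lambda>y. min 1 (trm_val add_hoop (dehomog d y) s))"
    by (elim mv_definable_cong) (simp add: clip_def)
  then show ?thesis by (simp add: mv_definable_def)
qed

interpretation hoop: implicative_generator hoop_ar HOne HImp add_hoop
proof
  show "hoop_ar f = 0 \<or> hoop_ar f = 2" for f by (cases f) auto
  fix f and x y z :: real
  assume "hoop_ar f = 2"
  then have f: "f = HMul \<or> f = HImp" by (cases f) auto
  show "oper add_hoop HImp [oper add_hoop HImp [x, y], oper add_hoop HImp [oper add_hoop HImp [y, x],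
          oper add_hoop HImp [oper add_hoop f [x, z], oper add_hoop f [y, z]]]] =
        oper add_hoop HOne []"
    using f by (elim disjE) (simp_all add: max_def)
  show "oper add_hoop HImp [oper add_hoop HImp [x, y], oper add_hoop HImp [oper add_hoop HImp [y, x],
          oper add_hoop HImp [oper add_hoop f [z, x], oper add_hoop f [z, y]]]] =
        oper add_hoop HOne []"
    using f by (elim disjE) (simp_all add: max_def)
qed (auto simp: max_def)

interpretation mv: implicative_generator mv_ar MVOne MVImp add_mv
proof
  show "mv_ar f = 0 \<or> mv_ar f = 2" for f by (cases f) auto
  fix f and x y z :: real
  assume "mv_ar f = 2"
  then have f: "f = MVMul \<or> f = MVImp" by (cases f) auto
  show "oper add_mv MVImp [oper add_mv MVImp [x, y], oper add_mv MVImp [oper add_mv MVImp [y, x],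
          oper add_mv MVImp [oper add_mv f [x, z], oper add_mv f [y, z]]]] =
        oper add_mv MVOne []"
    using f by (elim disjE) (simp_all add: max_def min_def)
  show "oper add_mv MVImp [oper add_mv MVImp [x, y], oper add_mv MVImp [oper add_mv MVImp [y, x],
          oper add_mv MVImp [oper add_mv f [z, x], oper add_mv f [z, y]]]] =
        oper add_mv MVOne []"
    using f by (elim disjE) (simp_all add: max_def min_def)
qed (auto simp: max_def)

section \<open>Maps out of free algebras\<close>

lemma free_alg_carr_cases:
  assumes "x \<in> carr (free_alg ar M k)"
  obtains t where "t \<in> terms ar {..<k}" "x = ident_rel ar M k `` {t}"
  using assms by (auto simp: free_alg_def quotient_def)

lemma free_alg_carr: "t \<in> terms ar {..<k} \<Longrightarrow> ident_rel ar M k `` {t} \<in> carr (free_alg ar M k)"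
  by (auto simp: free_alg_def quotient_def)

lemma ident_rel_class_eqI:
  "\<lbrakk>s \<in> terms ar {..<k}; t \<in> terms ar {..<k}; identity_holds M s t\<rbrakk> \<Longrightarrow>
   ident_rel ar M k `` {s} = ident_rel ar M k `` {t}"
  by (intro equiv_class_eq[OF equiv_ident_rel]) (simp add: ident_rel_def)

lemma free_alg_lift:
  assumes "\<And>s t. s \<in> terms ar {..<k} \<Longrightarrow> t \<in> terms ar {..<k} \<Longrightarrow> identity_holds M s t \<Longrightarrow> g s = g t"
  obtains h where "\<And>t. t \<in> terms ar {..<k} \<Longrightarrow> h (ident_rel ar M k `` {t}) = g t"
proof
  fix t assume t: "t \<in> terms ar {..<k}"
  let ?u = "SOME u. u \<in> ident_rel ar M k `` {t}"
  have "?u \<in> ident_rel ar M k `` {t}"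
    by (rule someI) (rule equiv_class_self[OF equiv_ident_rel t])
  then have "?u \<in> terms ar {..<k}" "identity_holds M t ?u" by (auto simp: ident_rel_def)
  from assms[OF t this] show "g ?u = g t" by simp
qed

lemma (in implicative_generator) alg_filter_free_alg_iff:
  assumes M: "is_alg ar M"
  shows "alg_filter ar e M (free_alg ar M k) F \<longleftrightarrow>
    F \<subseteq> carr (free_alg ar M k) \<and> ident_rel ar M k `` {App e []} \<in> F \<and>
    (\<forall>s\<in>terms ar {..<k}. \<forall>t\<in>terms ar {..<k}. ident_rel ar M k `` {s} \<in> F \<longrightarrow>
       ident_rel ar M k `` {App i [s, t]} \<in> F \<longrightarrow> ident_rel ar M k `` {t} \<in> F)"
proof -
  let ?A = "free_alg ar M k" and ?c = "\<lambda>t. ident_rel ar M k `` {t}"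
  have A: "in_variety ar M ?A"
    using one_term by (intro free_alg_in_variety[OF M]) blast
  have one: "oper ?A e [] = ?c (App e [])"
    using oper_free_alg[of "[]" ar e k M] ar_e by simp
  have imp: "oper ?A i [?c s, ?c t] = ?c (App i [s, t])"
    if "s \<in> terms ar {..<k}" "t \<in> terms ar {..<k}" for s t
    using oper_free_alg[of "[s, t]" ar i k M] ar_i that by simp
  have "(\<forall>a\<in>F. \<forall>b\<in>carr ?A. oper ?A i [a, b] \<in> F \<longrightarrow> b \<in> F) \<longleftrightarrow>
      (\<forall>s\<in>terms ar {..<k}. \<forall>t\<in>terms ar {..<k}. ?c s \<in> F \<longrightarrow> ?c (App i [s, t]) \<in> F \<longrightarrow> ?c t \<in> F)"
    (is "?L \<longleftrightarrow> ?R") if F: "F \<subseteq> carr ?A"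
  proof
    assume ?L
    then show ?R using imp free_alg_carr by metis
  next
    assume R: ?R
    show ?L
    proof (intro ballI impI)
      fix a b assume ab: "a \<in> F" "b \<in> carr ?A" "oper ?A i [a, b] \<in> F"
      obtain s where s: "s \<in> terms ar {..<k}" "a = ?c s"
        using free_alg_carr_cases ab(1) F by blast
      obtain t where t: "t \<in> terms ar {..<k}" "b = ?c t"
        using free_alg_carr_cases ab(2) by blast
      show "b \<in> F" using R s t ab imp by metis
    qed
  qed
  then show ?thesis unfolding alg_filter_iff_implicative[OF A] one by blast
qed

section \<open>The correspondence of filters\<close>

lemma identity_holds_add_hoop:
  "\<lbrakk>s \<in> terms hoop_ar UNIV; t \<in> terms hoop_ar UNIV\<rbrakk> \<Longrightarrow>
   identity_holds product_alg s t \<longleftrightarrow> identity_holds add_hoop s t"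
  by (simp add: identity_holds_bij_hom[OF is_alg_add_hoop add_hoop_hom add_hoop_bij])

lemma identity_holds_add_mv:
  "\<lbrakk>s \<in> terms mv_ar UNIV; t \<in> terms mv_ar UNIV\<rbrakk> \<Longrightarrow>
   identity_holds lukasiewicz_alg s t \<longleftrightarrow> identity_holds add_mv s t"
  by (simp add: identity_holds_bij_hom[OF is_alg_add_mv add_mv_hom add_mv_bij])

lemma Spec_add_hoop_homeomorphic_Spec_add_mv:
  "Spec hoop_ar HOne add_hoop (free_alg hoop_ar add_hoop (Suc d)) homeomorphic_space
   Spec mv_ar MVOne add_mv (free_alg mv_ar add_mv d)"
proof -
  let ?S = "terms hoop_ar {..<Suc d}" and ?T = "terms mv_ar {..<d}"
  let ?A = "free_alg hoop_ar add_hoop (Suc d)" and ?B = "free_alg mv_ar add_mv d"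
  let ?a = "\<lambda>s. ident_rel hoop_ar add_hoop (Suc d) `` {s}"
  let ?b = "\<lambda>t. ident_rel mv_ar add_mv d `` {t}"
  let ?hv = "trm_val add_hoop" and ?mv = "trm_val add_mv"
  note filter_A = hoop.alg_filter_free_alg_iff[OF is_alg_add_hoop, of "Suc d"]
  note filter_B = mv.alg_filter_free_alg_iff[OF is_alg_add_mv, of d]

  have mp_A: "?a t \<in> F"
    if "alg_filter hoop_ar HOne add_hoop ?A F" "s \<in> ?S" "t \<in> ?S" "?a s \<in> F"
      "?a (App HImp [s, t]) \<in> F" for F s t
    using that unfolding filter_A by blast
  have mp_B: "?b t \<in> G"
    if "alg_filter mv_ar MVOne add_mv ?B G" "s \<in> ?T" "t \<in> ?T" "?b s \<in> G"
      "?b (App MVImp [s, t]) \<in> G" for G s t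
    using that unfolding filter_B by blast

  have eq_A: "?a s = ?a t"
    if "s \<in> ?S" "t \<in> ?S" "\<And>x. (\<And>i. 0 \<le> x i) \<Longrightarrow> ?hv x s = ?hv x t" for s t
    using that by (intro ident_rel_class_eqI) (simp_all add: identity_holds_def)
  have eq_B: "?b s = ?b t"
    if "s \<in> ?T" "t \<in> ?T" "\<And>y. (\<And>i. y i \<in> {0..1}) \<Longrightarrow> ?mv y s = ?mv y t" for s t
    using that by (intro ident_rel_class_eqI) (simp_all add: identity_holds_def)

  have "\<forall>s\<in>?S. \<exists>t. t \<in> ?T \<and> (\<forall>y. (\<forall>i. y i \<in> {0..1}) \<longrightarrow> ?mv y t = min 1 (?hv (dehomog d y) s))"
    using dehomog_trm_exists by blast
  then obtain D where D_terms: "\<And>s. s \<in> ?S \<Longrightarrow> D s \<in> ?T"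
    and D_val: "\<And>s y. s \<in> ?S \<Longrightarrow> (\<And>i. y i \<in> {0..1}) \<Longrightarrow> ?mv y (D s) = min 1 (?hv (dehomog d y) s)"
    by metis

  have D_cong: "?b (D s) = ?b (D t)" if "s \<in> ?S" "t \<in> ?S" "identity_holds add_hoop s t" for s t
  proof (rule eq_B)
    fix y :: "nat \<Rightarrow> real" assume y: "\<And>i. y i \<in> {0..1}"
    have "?hv (dehomog d y) s = ?hv (dehomog d y) t"
      using that(3) dehomog_nonneg[of y, OF y] by (simp add: identity_holds_def)
    then show "?mv y (D s) = ?mv y (D t)" using that D_val y by simp
  qed (use that D_terms in auto)
  obtain \<alpha> where \<alpha>: "\<And>s. s \<in> ?S \<Longrightarrow> \<alpha> (?a s) = ?b (D s)"
    by (rule free_alg_lift[of hoop_ar "Suc d" add_hoop "\<lambda>s. ?b (D s)"]) (use D_cong in auto)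

  define coords where "coords x i = (if i < d then x i / hoop_unit d x else 0)"
    for x :: "nat \<Rightarrow> real" and i
  have unit_zero: "x i = 0" if "\<And>i. 0 \<le> x i" "hoop_unit d x = 0" "i \<le> d" for x i
  proof -
    have "coord_max d x = 0" "x d = 0"
      using that(1)[of d] that(2) coord_max_nonneg[of d x] by (auto simp: hoop_unit_def)
    then show ?thesis using coord_max_ge[of i d x] that(1)[of i] that(3) by (cases "i = d") auto
  qed
  have unit_nonneg: "0 \<le> hoop_unit d x" if "\<And>i. 0 \<le> x i" for x
    using that[of d] coord_max_nonneg[of d x] by (simp add: hoop_unit_def)
  have coords_scale: "x i = hoop_unit d x * coords x i" if "\<And>i. 0 \<le> x i" "i < d" for x i
    using unit_zero[of x i] that by (simp add: coords_def)
  have coords_bounds: "coords x i \<in> {0..1}" if x: "\<And>i. 0 \<le> x i" for x i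
  proof (cases "i < d")
    case True
    then have "x i \<le> hoop_unit d x"
      using coord_max_ge[of i d x] x[of d] by (simp add: hoop_unit_def)
    then show ?thesis using x[of i] unit_nonneg[of x, OF x] True
      by (auto simp: coords_def divide_le_eq_1)
  qed (simp add: coords_def)
  have val_homog: "?hv x (homog_trm d t) = hoop_unit d x * ?mv (coords x) t"
    if "t \<in> ?T" "\<And>i. 0 \<le> x i" for t x
    by (intro trm_val_homog that coords_bounds coords_scale)

  have homog_cong: "?a (homog_trm d s) = ?a (homog_trm d t)"
    if "s \<in> ?T" "t \<in> ?T" "identity_holds add_mv s t" for s t
  proof (rule eq_A)
    fix x :: "nat \<Rightarrow> real" assume x: "\<And>i. 0 \<le> x i"
    have "?mv (coords x) s = ?mv (coords x) t"
      using that(3) coords_bounds[of x, OF x] by (simp add: identity_holds_def)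
    then show "?hv x (homog_trm d s) = ?hv x (homog_trm d t)" using that val_homog x by simp
  qed (use that homog_trm_terms in auto)
  obtain \<beta> where \<beta>: "\<And>t. t \<in> ?T \<Longrightarrow> \<beta> (?b t) = ?a (homog_trm d t)"
    by (rule free_alg_lift[of mv_ar d add_mv "\<lambda>t. ?a (homog_trm d t)"])
       (use homog_cong in auto)

  have \<alpha>\<beta>: "\<alpha> (\<beta> (?b t)) = ?b t" if t: "t \<in> ?T" for t
  proof -
    have "?b (D (homog_trm d t)) = ?b t"
    proof (rule eq_B)
      fix y :: "nat \<Rightarrow> real" assume y: "\<And>i. y i \<in> {0..1}"
      have "?hv (dehomog d y) (homog_trm d t) = hoop_unit d (dehomog d y) * ?mv y t"
        using y by (intro trm_val_homog t dehomog_nonneg)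
          (simp_all add: hoop_unit_dehomog dehomog_def)
      then show "?mv y (D (homog_trm d t)) = ?mv y t"
        using D_val[OF homog_trm_terms[OF t] y] mv_val_bounds[OF t y] by (simp add: hoop_unit_dehomog)
    qed (use t D_terms homog_trm_terms in auto)
    then show ?thesis using t \<alpha> \<beta> homog_trm_terms by simp
  qed

  have val_homog_D: "?hv x (homog_trm d (D s)) = min (hoop_unit d x) (?hv x s)"
    if s: "s \<in> ?S" and x: "\<And>i. 0 \<le> x i" for s x
  proof -
    let ?u = "hoop_unit d x"
    have "?u * dehomog d (coords x) i = x i" if "i < Suc d" for i
    proof (cases "i < d")
      case True
      then show ?thesis using coords_scale[of x, OF x] by (simp add: dehomog_def)
    next
      case False
      have "?u * coord_max k (coords x) = coord_max k x" if "k \<le> d" for k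
        using that unit_nonneg[of x, OF x] coords_scale[of x, OF x]
        by (induction k) (simp_all add: max_mult_distrib_left)
      moreover have "i = d" using False \<open>i < Suc d\<close> by simp
      ultimately show ?thesis by (simp add: dehomog_def right_diff_distrib hoop_unit_def)
    qed
    then have "?hv (\<lambda>i. ?u * dehomog d (coords x) i) s = ?hv x s"
      by (intro trm_val_cong[OF s]) auto
    then have "?u * ?hv (dehomog d (coords x)) s = ?hv x s"
      by (simp add: hoop_val_scale[OF s unit_nonneg[of x, OF x]])
    then show ?thesis
      using val_homog[OF D_terms[OF s] x] D_val[OF s coords_bounds[of x, OF x]] unit_nonneg[of x, OF x]
      by (simp add: min_mult_distrib_left)
  qed

  have filter_A_mult: "?a s \<in> F"
    if F: "alg_filter hoop_ar HOne add_hoop ?A F" and r: "r \<in> ?S" "?a r \<in> F" and s: "s \<in> ?S"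
      and le: "\<And>x. (\<And>i. 0 \<le> x i) \<Longrightarrow> ?hv x s \<le> real m * ?hv x r" for F m r s
    using s le
  proof (induction m arbitrary: s)
    case 0
    have "?hv x s = 0" if "\<And>i. 0 \<le> x i" for x
      using 0(2)[of x, OF that] hoop_val_nonneg[OF 0(1), of x] that by simp
    then have "?a s = ?a (App HOne [])"
      by (intro eq_A 0(1) hoop_terms_intros) simp
    then show ?case using F filter_A by simp
  next
    case (Suc m)
    have "?hv x (App HImp [r, s]) \<le> real m * ?hv x r" if x: "\<And>i. 0 \<le> x i" for x
      using Suc(3)[of x, OF x] hoop_val_nonneg[OF r(1), of x] x by (simp add: distrib_right)
    then have "?a (App HImp [r, s]) \<in> F"
      by (rule Suc.IH[OF hoop_terms_intros(3)[OF r(1) Suc(2)]])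
    then show ?case by (rule mp_A[OF F r(1) Suc(2) r(2)])
  qed

  have \<beta>\<alpha>: "\<beta> (\<alpha> (?a s)) \<in> F \<longleftrightarrow> ?a s \<in> F"
    if F: "alg_filter hoop_ar HOne add_hoop ?A F" and s: "s \<in> ?S" for F s
  proof -
    let ?r = "homog_trm d (D s)"
    have r: "?r \<in> ?S" using s D_terms homog_trm_terms by simp
    obtain m where m: "\<forall>x. (\<forall>i. 0 \<le> x i) \<longrightarrow> ?hv x s \<le> real m * hoop_unit d x"
      using hoop_val_le_unit[OF s] by blast
    have "?hv x s \<le> real (Suc m) * ?hv x ?r" if x: "\<And>i. 0 \<le> x i" for x
    proof (cases "?hv x s \<le> hoop_unit d x")
      case True
      have "0 \<le> ?hv x s" using hoop_val_nonneg[OF s] x by blast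
      then show ?thesis using True val_homog_D[of s x, OF s x] by (simp add: distrib_right)
    next
      case False
      have "?hv x s \<le> real m * hoop_unit d x" using m x by blast
      then show ?thesis using False val_homog_D[of s x, OF s x] unit_nonneg[of x, OF x]
        by (simp add: distrib_right)
    qed
    then have "?a ?r \<in> F \<Longrightarrow> ?a s \<in> F" using filter_A_mult[OF F r _ s] by blast
    moreover have "?a s \<in> F \<Longrightarrow> ?a ?r \<in> F"
      by (rule filter_A_mult[OF F s _ r, where m = 1]) (simp_all add: val_homog_D[OF s])
    ultimately show ?thesis using s \<alpha> \<beta> D_terms by auto
  qed

  have \<beta>_filter: "alg_filter mv_ar MVOne add_mv ?B {b \<in> carr ?B. \<beta> b \<in> F}"
    if F: "alg_filter hoop_ar HOne add_hoop ?A F" for F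
    unfolding filter_B
  proof (intro conjI ballI impI)
    show "?b (App MVOne []) \<in> {b \<in> carr ?B. \<beta> b \<in> F}"
      using \<beta>[of "App MVOne []"] F filter_A by (simp add: mv_terms_intros free_alg_carr)
    fix s t assume st: "s \<in> ?T" "t \<in> ?T" and s: "?b s \<in> {b \<in> carr ?B. \<beta> b \<in> F}"
      and imp: "?b (App MVImp [s, t]) \<in> {b \<in> carr ?B. \<beta> b \<in> F}"
    have "?a (homog_trm d s) \<in> F" using s \<beta> st by simp
    moreover have "?a (App HImp [homog_trm d s, homog_trm d t]) \<in> F"
      using imp \<beta>[of "App MVImp [s, t]"] st by (simp add: mv_terms_intros)
    ultimately have "?a (homog_trm d t) \<in> F"
      by (rule mp_A[OF F homog_trm_terms[OF st(1)] homog_trm_terms[OF st(2)]])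
    then show "?b t \<in> {b \<in> carr ?B. \<beta> b \<in> F}" using \<beta> st by (simp add: free_alg_carr)
  qed auto

  have \<alpha>_filter: "alg_filter hoop_ar HOne add_hoop ?A {a \<in> carr ?A. \<alpha> a \<in> G}"
    if G: "alg_filter mv_ar MVOne add_mv ?B G" for G
    unfolding filter_A
  proof (intro conjI ballI impI)
    have oneS: "App HOne [] \<in> ?S" by (rule hoop_terms_intros)
    have "?b (D (App HOne [])) = ?b (App MVOne [])"
      using D_val[OF oneS] by (intro eq_B) (auto intro: mv_terms_intros D_terms oneS)
    then show "?a (App HOne []) \<in> {a \<in> carr ?A. \<alpha> a \<in> G}"
      using \<alpha>[OF oneS] G filter_B oneS by (simp add: free_alg_carr)
    fix s t assume st: "s \<in> ?S" "t \<in> ?S" and s: "?a s \<in> {a \<in> carr ?A. \<alpha> a \<in> G}"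
      and imp: "?a (App HImp [s, t]) \<in> {a \<in> carr ?A. \<alpha> a \<in> G}"
    let ?i = "App HImp [s, t]"
    have i: "?i \<in> ?S" using st hoop_terms_intros by blast
    have "?b (App MVImp [D s, App MVImp [D ?i, D t]]) = ?b (App MVOne [])"
    proof (rule eq_B)
      fix y :: "nat \<Rightarrow> real" assume y: "\<And>i. y i \<in> {0..1}"
      have "0 \<le> ?hv (dehomog d y) s" "0 \<le> ?hv (dehomog d y) t"
        by (intro hoop_val_nonneg[OF st(1)] hoop_val_nonneg[OF st(2)] dehomog_nonneg y)+
      then show "?mv y (App MVImp [D s, App MVImp [D ?i, D t]]) = ?mv y (App MVOne [])"
        using D_val[OF st(1) y] D_val[OF st(2) y] D_val[OF i y] by auto
    qed (auto intro!: mv_terms_intros D_terms st i)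
    moreover have "?b (App MVOne []) \<in> G" using G unfolding filter_B by blast
    moreover have "?b (D s) \<in> G" "?b (D ?i) \<in> G" using s imp \<alpha> st i by simp_all
    ultimately have "?b (App MVImp [D ?i, D t]) \<in> G"
      using mp_B[OF G D_terms[OF st(1)] mv_terms_intros(3)[OF D_terms[OF i] D_terms[OF st(2)]]]
      by simp
    with \<open>?b (D ?i) \<in> G\<close> have "?b (D t) \<in> G"
      by (rule mp_B[OF G D_terms[OF i] D_terms[OF st(2)]])
    then show "?a t \<in> {a \<in> carr ?A. \<alpha> a \<in> G}" using \<alpha> st by (simp add: free_alg_carr)
  qed auto

  show ?thesis
  proof (rule Spec_homeomorphic[where \<alpha> = \<alpha> and \<beta> = \<beta>])
    show "\<alpha> a \<in> carr ?B" if "a \<in> carr ?A" for a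
      using free_alg_carr_cases[OF that] \<alpha> D_terms free_alg_carr by metis
    show "\<beta> b \<in> carr ?A" if "b \<in> carr ?B" for b
      using free_alg_carr_cases[OF that] \<beta> homog_trm_terms free_alg_carr by metis
    show "\<beta> (\<alpha> a) \<in> F \<longleftrightarrow> a \<in> F"
      if "alg_filter hoop_ar HOne add_hoop ?A F" "a \<in> carr ?A" for F a
      using free_alg_carr_cases[OF that(2)] \<beta>\<alpha>[OF that(1)] by metis
    show "\<alpha> (\<beta> b) \<in> G \<longleftrightarrow> b \<in> G" if "b \<in> carr ?B" for G b
      using free_alg_carr_cases[OF that] \<alpha>\<beta> by metis
  qed (use \<alpha>_filter \<beta>_filter in auto)
qed

theorem theorem4p1:
  fixes n :: nat
  assumes "n \<ge> 1"
  shows "Spec_V (Free_V n) homeomorphic_space Spec_MV (Free_MV (n - 1))"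
proof -
  have "Spec_V (Free_V n) = Spec hoop_ar HOne add_hoop (free_alg hoop_ar add_hoop (Suc (n - 1)))"
    using assms Spec_free_alg_generator_cong[OF identity_holds_add_hoop]
    by (simp add: Spec_V_def Free_V_def)
  moreover have "Spec_MV (Free_MV (n - 1)) = Spec mv_ar MVOne add_mv (free_alg mv_ar add_mv (n - 1))"
    using Spec_free_alg_generator_cong[OF identity_holds_add_mv]
    by (simp add: Spec_MV_def Free_MV_def)
  ultimately show ?thesis using Spec_add_hoop_homeomorphic_Spec_add_mv by simp
qed

end
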